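(* Fix $n$, $\lambda>0$, $\alpha\in(0,1)$ and $\eta\in(0,1)$ with $\eta<\min(\alpha,\frac{1-\alpha}{2})$. Define $\hat t_\alpha$ by $\mathbb P(\|\mathfrak B\|>\hat t_\alpha\mid D)=\alpha$. Suppose there are functions $(Q,R,L,B)$ such that the following high-level conditions hold: (i) (Gaussian approximation) there exists a Gaussian random element $Z$ in $H$ with covariance $\Sigma$ such that with probability at least $1-\eta$, $\|\sqrt n(\hat f-f_\lambda)-Z\|\le Q(n,\lambda,\eta)$; (ii) (Bootstrap approximation) there exists a random element $Z'$ in $H$ whose conditional distribution given $D$ is almost surely Gaussian with covariance $\Sigma$, and with probability at least $1-\eta$, $\mathbb P\{\|\mathfrak B-Z'\|\le R(n,\lambda,\eta)\mid D\}\ge1-\eta$; (iii) (Variance lower bound) for every $\eta'\in(0,1)$, with probability at least $1-\eta'$, $\|Z\|\ge L(\lambda,\eta')$, where $L$ is strictly increasing in its second argument; (iv) (Bias upper bound) $\sqrt n\|f_\lambda-f_0\|\le B(\lambda)$. Let $\Delta(n,\lambda,\eta)=Q(n,\lambda,\eta)+R(n,\lambda,\eta)$ and suppose the incremental factor $\delta$ satisfies $$\frac12\ge\delta\ge\frac{\Delta(n,\lambda,\eta)+B(\lambda)}{L(\lambda,1-\alpha-2\eta)-\Delta(n,\lambda,\eta)},$$ where the denominator is positive. Then $\hat C_\alpha=\{\hat f+\hat t_\alpha n^{-1/2}f:\ f\in H,\ \|f\|\le1+\delta\}$ is $(3\eta)$-valid and $(2\delta,3\eta)$-sharp at level $\alpha$,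 i.e. $\mathbb P(f_0\in\hat C_\alpha)\ge1-\alpha-3\eta$ and $\mathbb P\{f_0\in2\delta\hat f+(1-2\delta)\hat C_\alpha\}\le1-\alpha+3\eta$.
   Context: Setting. $S$ is a Polish space and $k:S\times S\to\mathbb R$ is a positive definite kernel with $k(x,x')\le\kappa^2$. $H$ is the (separable) reproducing kernel Hilbert space of $k$, with norm $\|\cdot\|$; $k_x=k(x,\cdot)$, $f(x)=\langle f,k_x\rangle$. The data $D=\{(X_i,Y_i)\}_{i=1}^n$ are i.i.d. in $S\times\mathbb R$; $f_0(x)=\mathbb E(Y\mid X=x)$, $f_0\in H$; $\varepsilon_i=Y_i-f_0(X_i)$ satisfies $|\varepsilon_i|\le\bar\sigma$ and $\mathbb E(\varepsilon_i^2\mid X_i)\ge\underline\sigma^2>0$. $\mathbb E_n(\cdot)=\frac1n\sum_{i=1}^n(\cdot)$; $u\otimes v^*:t\mapsto\langle v,t\rangle u$; $T=\mathbb E(k_X\otimes k_X^* )$, $\hat T=\mathbb E_n(k_X\otimes k_X^* )$. $\hat f=\arg\min_{f\in H}[\mathbb E_n\{Y-f(X)\}^2+\lambda\|f\|^2]$ and $f_\lambda=\arg\min_{f\in H}[\mathbb E\{Y-f(X)\}^2+\lambda\|f\|^2]$. $U_i=(T+\lambda)^{-1}\{(k_{X_i}\otimes k_{X_i}^*-T)(f_0-f_\lambda)+\varepsilon_ik_{X_i}\}$ and $\Sigma=\mathbb E(U_i\otimes U_i^* )$. Bootstrap. $\hat\varepsilon_i=Y_i-\hat f(X_i)$, $\hat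 V_i=(\hat T+\lambda)^{-1}\hat\varepsilon_ik_{X_i}$, $\mathfrak B=\frac1n\sum_{i=1}^n\sum_{j=1}^n\frac{\hat V_i-\hat V_j}{\sqrt2}h_{ij}$ with $h_{ij}$ i.i.d. standard Gaussians independent of $D$; $\hat t_\alpha$ is the conditional $(1-\alpha)$-quantile of $\|\mathfrak B\|$ given $D$. Gaussian elements are centered. *)

theory Defs
  imports "HOL-Probability.Probability"
begin

definition pos_def_kernel :: "('s \<Rightarrow> 's \<Rightarrow> real) \<Rightarrow> bool" where
  "pos_def_kernel k \<longleftrightarrow>
     (\<forall>x y. k x y = k y x) \<and>
     (\<forall>A c. finite A \<longrightarrow> (\<Sum>x\<in>A. \<Sum>y\<in>A. c x * c y * k x y) \<ge> 0)"

text \<open>A reproducing kernel Hilbert space is modelled by a Hilbert space type \<open>'h\<close> together with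
  the injective map \<open>evl\<close> that sends an element to the function on \<open>'s\<close> it stands for. Linearity of
  \<open>evl\<close> for the pointwise operations is a consequence of the reproducing property.\<close>

definition rkhs ::
  "('s \<Rightarrow> 's \<Rightarrow> real) \<Rightarrow> ('h::{real_inner, banach} \<Rightarrow> 's \<Rightarrow> real) \<Rightarrow> bool" where
  "rkhs k evl \<longleftrightarrow> inj evl \<and> (\<forall>x. \<exists>kx. evl kx = k x \<and> (\<forall>f. evl f x = inner f kx))"

text \<open>\<open>ksec k evl x\<close> is \<open>k(x, \<cdot>)\<close> as an element of the Hilbert space.\<close>

definition ksec :: "('s \<Rightarrow> 's \<Rightarrow> real) \<Rightarrow> ('h \<Rightarrow> 's \<Rightarrow> real) \<Rightarrow> 's \<Rightarrow> 'h" where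
  "ksec k evl x = inv evl (k x)"

definition tensor :: "'h::real_inner \<Rightarrow> 'h \<Rightarrow> 'h \<Rightarrow> 'h" where
  "tensor u v = (\<lambda>t. inner v t *\<^sub>R u)"

text \<open>Expectation of a random operator, in the strong sense. (The bounded operators on an
  infinite-dimensional space are not second countable, so the Bochner integral of the library
  is not available for them.)\<close>

definition op_expectation ::
  "'a measure \<Rightarrow> ('a \<Rightarrow> 'h \<Rightarrow> 'h::{banach, second_countable_topology}) \<Rightarrow> 'h \<Rightarrow> 'h" where
  "op_expectation M F = (\<lambda>t. \<integral>\<omega>. F \<omega> t \<partial>M)"

definition emp_mean :: "nat \<Rightarrow> (nat \<Rightarrow> 'b::real_vector) \<Rightarrow> 'b" where
  "emp_mean n g = (1 / real n) *\<^sub>R (\<Sum>i<n. g i)"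

definition reg_inv :: "('h::real_vector \<Rightarrow> 'h) \<Rightarrow> real \<Rightarrow> 'h \<Rightarrow> 'h" where
  "reg_inv A lam = inv (\<lambda>t. A t + lam *\<^sub>R t)"

text \<open>Population quantities; \<open>P\<close> is the common law of the observations \<open>(X, Y)\<close>.\<close>

definition cov_op ::
  "('s \<times> real) measure \<Rightarrow> ('s \<Rightarrow> 's \<Rightarrow> real) \<Rightarrow>
   ('h::{real_inner, banach, second_countable_topology} \<Rightarrow> 's \<Rightarrow> real) \<Rightarrow> 'h \<Rightarrow> 'h" where
  "cov_op P k evl =
     op_expectation P (\<lambda>(x, y). tensor (ksec k evl x) (ksec k evl x))"

definition krr_pop ::
  "('s \<times> real) measure \<Rightarrow> ('h::{real_inner, banach, second_countable_topology} \<Rightarrow> 's \<Rightarrow> real) \<Rightarrow>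
   real \<Rightarrow> 'h" where
  "krr_pop P evl lam =
     arg_min (\<lambda>f. (\<integral>(x, y). (y - evl f x)\<^sup>2 \<partial>P) + lam * (norm f)\<^sup>2) (\<lambda>_. True)"

definition influence ::
  "('s \<times> real) measure \<Rightarrow> ('s \<Rightarrow> 's \<Rightarrow> real) \<Rightarrow>
   ('h::{real_inner, banach, second_countable_topology} \<Rightarrow> 's \<Rightarrow> real) \<Rightarrow>
   real \<Rightarrow> 'h \<Rightarrow> 's \<times> real \<Rightarrow> 'h" where
  "influence P k evl lam f0 = (\<lambda>(x, y).
     let b = f0 - krr_pop P evl lam in
     reg_inv (cov_op P k evl) lam
       ((tensor (ksec k evl x) (ksec k evl x) b - cov_op P k evl b) +
        (y - evl f0 x) *\<^sub>R ksec k evl x))"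

definition Sigma_op ::
  "('s \<times> real) measure \<Rightarrow> ('s \<Rightarrow> 's \<Rightarrow> real) \<Rightarrow>
   ('h::{real_inner, banach, second_countable_topology} \<Rightarrow> 's \<Rightarrow> real) \<Rightarrow>
   real \<Rightarrow> 'h \<Rightarrow> 'h \<Rightarrow> 'h" where
  "Sigma_op P k evl lam f0 =
     op_expectation P (\<lambda>p. tensor (influence P k evl lam f0 p) (influence P k evl lam f0 p))"

text \<open>Sample quantities; \<open>x i\<close> and \<open>y i\<close>, \<open>i < n\<close>, are the observed values.\<close>

definition emp_cov_op ::
  "nat \<Rightarrow> ('s \<Rightarrow> 's \<Rightarrow> real) \<Rightarrow> ('h::real_inner \<Rightarrow> 's \<Rightarrow> real) \<Rightarrow> (nat \<Rightarrow> 's) \<Rightarrow> 'h \<Rightarrow> 'h" where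
  "emp_cov_op n k evl x = (\<lambda>t. emp_mean n (\<lambda>i. tensor (ksec k evl (x i)) (ksec k evl (x i)) t))"

definition krr_est ::
  "nat \<Rightarrow> ('h::real_inner \<Rightarrow> 's \<Rightarrow> real) \<Rightarrow> real \<Rightarrow> (nat \<Rightarrow> 's) \<Rightarrow> (nat \<Rightarrow> real) \<Rightarrow> 'h" where
  "krr_est n evl lam x y =
     arg_min (\<lambda>f. emp_mean n (\<lambda>i. (y i - evl f (x i))\<^sup>2) + lam * (norm f)\<^sup>2) (\<lambda>_. True)"

definition emp_influence ::
  "nat \<Rightarrow> ('s \<Rightarrow> 's \<Rightarrow> real) \<Rightarrow> ('h::real_inner \<Rightarrow> 's \<Rightarrow> real) \<Rightarrow> real \<Rightarrow>
   (nat \<Rightarrow> 's) \<Rightarrow> (nat \<Rightarrow> real) \<Rightarrow> nat \<Rightarrow> 'h" where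
  "emp_influence n k evl lam x y i =
     reg_inv (emp_cov_op n k evl x) lam
       ((y i - evl (krr_est n evl lam x y) (x i)) *\<^sub>R ksec k evl (x i))"

definition bootstrap ::
  "nat \<Rightarrow> ('s \<Rightarrow> 's \<Rightarrow> real) \<Rightarrow> ('h::real_inner \<Rightarrow> 's \<Rightarrow> real) \<Rightarrow> real \<Rightarrow>
   (nat \<Rightarrow> 's) \<Rightarrow> (nat \<Rightarrow> real) \<Rightarrow> (nat \<Rightarrow> nat \<Rightarrow> real) \<Rightarrow> 'h" where
  "bootstrap n k evl lam x y h =
     (1 / real n) *\<^sub>R (\<Sum>i<n. \<Sum>j<n. h i j *\<^sub>R
       ((emp_influence n k evl lam x y i - emp_influence n k evl lam x y j) /\<^sub>R sqrt 2))"

definition cprob :: "'a measure \<Rightarrow> 'a measure \<Rightarrow> ('a \<Rightarrow> bool) \<Rightarrow> 'a \<Rightarrow> real" where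
  "cprob M F A = real_cond_exp M F (indicator {\<omega> \<in> space M. A \<omega>})"

definition cond_distr ::
  "'a measure \<Rightarrow> 'a measure \<Rightarrow> 'b measure \<Rightarrow> ('a \<Rightarrow> 'b) \<Rightarrow> ('a \<Rightarrow> 'b measure) \<Rightarrow> bool" where
  "cond_distr M F N X K \<longleftrightarrow>
     K \<in> F \<rightarrow>\<^sub>M prob_algebra N \<and>
     (\<forall>A\<in>sets N. AE \<omega> in M. measure (K \<omega>) A = cprob M F (\<lambda>\<omega>'. X \<omega>' \<in> A) \<omega>)"

text \<open>\<open>normal_law s\<close> is the law N(0, s^2), which is the point mass at 0 for \<open>s = 0\<close>. A centered
  Gaussian measure on a Hilbert space is one all of whose one-dimensional projections are of this
  kind; covariance operators are understood in the weak sense.\<close>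

definition normal_law :: "real \<Rightarrow> real measure" where
  "normal_law s = (if s = 0 then return borel 0 else density lborel (normal_density 0 s))"

definition centered_gaussian :: "'h::{real_inner, banach, second_countable_topology} measure \<Rightarrow> bool" where
  "centered_gaussian N \<longleftrightarrow> prob_space N \<and> sets N = sets borel \<and>
     (\<forall>u. \<exists>s\<ge>0. distr N borel (\<lambda>z. inner u z) = normal_law s)"

definition gaussian_with_cov ::
  "'h::{real_inner, banach, second_countable_topology} measure \<Rightarrow> ('h \<Rightarrow> 'h) \<Rightarrow> bool" where
  "gaussian_with_cov N C \<longleftrightarrow> centered_gaussian N \<and>
     (\<forall>u v. (\<integral>z. inner u z * inner v z \<partial>N) = inner u (C v))"

definition conf_set :: "nat \<Rightarrow> 'h::real_normed_vector \<Rightarrow> real \<Rightarrow> real \<Rightarrow> 'h set" where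
  "conf_set n fh t \<delta> = {fh + (t / sqrt (real n)) *\<^sub>R f | f. norm f \<le> 1 + \<delta>}"

text \<open>Both notions ask that the coverage event be measurable, since \<open>measure\<close> is 0 on
  non-measurable sets.\<close>

definition valid_set :: "'a measure \<Rightarrow> real \<Rightarrow> real \<Rightarrow> 'h \<Rightarrow> ('a \<Rightarrow> 'h set) \<Rightarrow> bool" where
  "valid_set M \<alpha> \<tau> f0 C \<longleftrightarrow>
     {\<omega> \<in> space M. f0 \<in> C \<omega>} \<in> sets M \<and>
     measure M {\<omega> \<in> space M. f0 \<in> C \<omega>} \<ge> 1 - \<alpha> - \<tau>"

definition sharp_set ::
  "'a measure \<Rightarrow> real \<Rightarrow> real \<Rightarrow> real \<Rightarrow> 'h::real_vector \<Rightarrow> ('a \<Rightarrow> 'h) \<Rightarrow> ('a \<Rightarrow> 'h set) \<Rightarrow> bool" where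
  "sharp_set M \<alpha> d \<tau> f0 fh C \<longleftrightarrow>
     {\<omega> \<in> space M. f0 \<in> (\<lambda>g. d *\<^sub>R fh \<omega> + (1 - d) *\<^sub>R g) ` C \<omega>} \<in> sets M \<and>
     measure M {\<omega> \<in> space M. f0 \<in> (\<lambda>g. d *\<^sub>R fh \<omega> + (1 - d) *\<^sub>R g) ` C \<omega>} \<le> 1 - \<alpha> + \<tau>"

end

theory Submission
  imports Defs
begin

text \<open>
  The confidence set is a ball around \<open>fhat\<close> whose radius is the bootstrap quantile, inflated by
  \<open>1 + \<delta>\<close>. Write \<open>W = sqrt n (fhat - f0)\<close> and \<open>S r = P (norm Z > r)\<close>. The bias bound and the Gaussian
  approximation give \<open>\<bar>norm W - norm Z\<bar> \<le> Q + B\<close> outside an event of probability \<open>\<eta>\<close>. The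
  bootstrap approximation says that, outside another such event, the conditional tails of
  \<open>norm BB\<close> and \<open>norm Z'\<close> agree up to a shift \<open>R\<close> of the argument and an error \<open>\<eta>\<close> in probability;
  since \<open>norm Z'\<close> has the unconditional law of \<open>norm Z\<close> given the data, the bootstrap quantile \<open>t\<close>
  satisfies \<open>S (t + R) \<le> \<alpha> + \<eta>\<close> and \<open>S (t - R) \<ge> \<alpha> - \<eta>\<close> (\<open>conditional_tail_transfer\<close>). The first of
  these and the lower bound \<open>L\<close> on \<open>norm Z\<close> force \<open>t \<ge> L - R\<close>, so that by its choice the slack
  \<open>\<delta> t\<close> absorbs the total error \<open>Q + B + R\<close>. Hence a miss of the inflated ball forces
  \<open>norm Z > t + R\<close>, and a hit of the deflated ball forces \<open>norm Z \<le> t - R\<close>.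

  The quantile \<open>t\<close> is random and depends on \<open>Z\<close> through the data, so these two events cannot be
  evaluated by conditioning. They are instead contained in events of the form
  \<open>G (\<zeta>) \<le> p\<close> with \<open>G\<close> the distribution function of \<open>\<zeta> = - norm Z\<close> or \<open>\<zeta> = norm Z\<close>, and such an
  event always has probability at most \<open>p\<close> (\<open>prob_cdf_transform_le\<close>), even if the law of
  \<open>\<zeta>\<close> has atoms. A union bound over the three events gives the error \<open>3 \<eta>\<close>
  (\<open>inflated_bootstrap_ball_coverage\<close>).

  Two facts behind this argument have proofs of their own. First, the covariance operator of a
  centered Gaussian law on a separable Hilbert space determines the law of the norm
  (\<open>gaussian_norm_law_unique\<close>): it determines all one-dimensional projections, these determine all
  cylinder probabilities by a Cramer--Wold argument, and a ball is a countable decreasing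
  intersection of cylinders. Second, the coverage events are measurable because the ridge
  estimator is a Borel function of the data (\<open>krr_est_borel_measurable\<close>): it solves a coercive
  linear equation, hence is the pointwise limit of an explicit iteration.
\<close>

section \<open>Distribution functions evaluated at their own variable\<close>

text \<open>The supremum of the set may or may not belong to it; the countable exhaustion treats both
  cases at once, so that probabilities of events \<open>\<zeta> \<in> A\<close> become limits of values of the
  distribution function.\<close>

lemma down_set_exhaustion:
  fixes A :: "real set"
  assumes ne: "A \<noteq> {}" and down: "\<And>x y. y \<in> A \<Longrightarrow> x \<le> y \<Longrightarrow> x \<in> A"
  obtains t :: "nat \<Rightarrow> real" where "incseq t" "A = (\<Union>m. {..t m})"
proof (cases "\<exists>a\<in>A. \<forall>x\<in>A. x \<le> a")
  case True
  then obtain a where "a \<in> A" "\<forall>x\<in>A. x \<le> a" by blast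
  then have "A = (\<Union>m::nat. {..a})" using down by auto
  then show thesis by (rule that[rotated]) (auto simp: incseq_def)
next
  case no_max: False
  show thesis
  proof (cases "bdd_above A")
    case True
    define t where "t m = Sup A - 1 / real (Suc m)" for m
    have "t m \<in> A" for m
    proof -
      have "t m < Sup A" by (simp add: t_def)
      then obtain a where "a \<in> A" "t m < a" using less_cSup_iff[OF ne True] by blast
      then show ?thesis using down less_imp_le by blast
    qed
    moreover have "\<exists>m. x \<le> t m" if "x \<in> A" for x
    proof -
      have "x < Sup A"
        using no_max that cSup_upper[OF _ True] by (metis order_le_less)
      then obtain m where "1 / real (Suc m) < Sup A - x"
        using nat_approx_posE[of "Sup A - x"] by auto
      then show ?thesis by (intro exI[of _ m]) (simp add: t_def)
    qed
    ultimately have "A = (\<Union>m. {..t m})" using down by blast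
    moreover have "incseq t" by (auto simp: incseq_def t_def frac_le)
    ultimately show thesis by (rule that[rotated])
  next
    case False
    have "x \<in> A" for x
      using False down by (meson bdd_above.I linorder_le_cases)
    then have "A = (\<Union>m. {..real m})" using real_arch_simple by auto
    then show thesis by (rule that[rotated]) (auto simp: incseq_def)
  qed
qed

text \<open>A p-value computed from the true distribution is stochastically at least uniform, also in the
  presence of atoms: the event says that \<open>\<zeta>\<close> falls into the down-set of points with \<open>G \<le> p\<close>.\<close>

lemma (in prob_space) prob_cdf_transform_le:
  fixes \<zeta> :: "'a \<Rightarrow> real"
  assumes [measurable]: "\<zeta> \<in> borel_measurable M" and p: "0 \<le> p"
  defines "G \<equiv> \<lambda>x. prob {\<omega>\<in>space M. \<zeta> \<omega> \<le> x}"
  shows "{\<omega>\<in>space M. G (\<zeta> \<omega>) \<le> p} \<in> events" "prob {\<omega>\<in>space M. G (\<zeta> \<omega>) \<le> p} \<le> p"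
proof -
  have mono: "mono G" unfolding G_def by (auto intro!: monoI finite_measure_mono)
  from borel_measurable_mono[OF this]
  have [measurable]: "G \<in> borel_measurable borel" .
  show "{\<omega>\<in>space M. G (\<zeta> \<omega>) \<le> p} \<in> events" by measurable
  define A where "A = {x. G x \<le> p}"
  show "prob {\<omega>\<in>space M. G (\<zeta> \<omega>) \<le> p} \<le> p"
  proof (cases "A = {}")
    case True
    then show ?thesis using p by (simp add: A_def)
  next
    case False
    then obtain t :: "nat \<Rightarrow> real" where t: "incseq t" "A = (\<Union>m. {..t m})"
      by (rule down_set_exhaustion)
         (auto simp: A_def intro: order_trans[OF monoD[OF mono]])
    let ?E = "\<lambda>m. {\<omega>\<in>space M. \<zeta> \<omega> \<le> t m}"
    have "(\<lambda>m. prob (?E m)) \<longlonglongrightarrow> prob (\<Union>m. ?E m)"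
      using t(1) by (intro finite_Lim_measure_incseq)
        (auto simp: incseq_def intro: order_trans)
    moreover have "prob (?E m) \<le> p" for m
    proof -
      have "t m \<in> A" using t(2) by auto
      then show ?thesis by (simp add: A_def G_def)
    qed
    ultimately have "prob (\<Union>m. ?E m) \<le> p" by (intro LIMSEQ_le_const2) auto
    also have "(\<Union>m. ?E m) = {\<omega>\<in>space M. \<zeta> \<omega> \<in> A}" unfolding t(2) by auto
    finally show ?thesis by (simp add: A_def)
  qed
qed

section \<open>Conditional tail comparison\<close>

text \<open>\<open>real_cond_exp\<close> vanishes on functions that are not measurable. Hence a conditional probability
  that is not almost surely zero already shows that its event is measurable.\<close>

lemma AE_real_cond_exp_indicator_non_measurable:
  assumes sub: "subalgebra M F" "finite_measure M" and S: "S \<subseteq> space M" "S \<notin> sets M"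
  shows "AE \<omega> in M. real_cond_exp M F (indicator S) \<omega> = 0"
proof -
  interpret finite_measure M by fact
  interpret finite_measure_subalgebra M F by unfold_locales (rule sub)
  have "(\<lambda>x. ennreal (indicator S x)) \<notin> borel_measurable M"
  proof
    assume [measurable]: "(\<lambda>x. ennreal (indicator S x)) \<in> borel_measurable M"
    have "{x \<in> space M. ennreal (indicator S x) = 1} \<in> sets M" by measurable
    also have "{x \<in> space M. ennreal (indicator S x) = 1} = S"
      using S(1) by (auto simp: indicator_def split: if_splits)
    finally show False using S by simp
  qed
  moreover have "AE x in M. nn_cond_exp M F (\<lambda>x. ennreal (- indicator S x)) x = 0"
  proof -
    have *: "(\<lambda>x. ennreal (- indicator S x)) = (\<lambda>_. 0)"
      by (auto simp: indicator_def ennreal_neg)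
    show ?thesis unfolding * using nn_cond_exp_F_meas[of "\<lambda>_. 0"] by simp
  qed
  ultimately show ?thesis
    unfolding real_cond_exp_def by (auto simp: nn_cond_exp_def)
qed

lemma (in prob_space) AE_real_cond_exp_compl:
  assumes sub: "subalgebra M F" and A: "A \<in> events"
    and cond: "AE \<omega> in M. real_cond_exp M F (indicator A) \<omega> = a"
  shows "AE \<omega> in M. real_cond_exp M F (indicator (space M - A)) \<omega> = 1 - a"
proof -
  interpret finite_measure_subalgebra M F by unfold_locales (rule sub)
  have int: "integrable M (indicator A :: 'a \<Rightarrow> real)" using A by (simp add: emeasure_eq_measure)
  have "AE \<omega> in M. real_cond_exp M F (indicator (space M - A)) \<omega> =
      real_cond_exp M F (\<lambda>\<omega>. 1 - indicator A \<omega>) \<omega>"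
    using A by (intro real_cond_exp_cong AE_I2) (auto simp: indicator_def)
  moreover have "AE \<omega> in M. real_cond_exp M F (\<lambda>\<omega>. 1 - indicator A \<omega>) \<omega> =
      real_cond_exp M F (\<lambda>_. 1) \<omega> - real_cond_exp M F (indicator A) \<omega>"
    by (rule real_cond_exp_diff) (use int in simp_all)
  moreover have "AE \<omega> in M. real_cond_exp M F (\<lambda>_. 1) \<omega> = 1"
    by (rule real_cond_exp_F_meas) simp_all
  ultimately show ?thesis using cond by eventually_elim simp
qed

text \<open>On \<open>N\<close>, the tail event \<open>V\<close> taken at the random level \<open>\<tau>\<close> implies \<open>A\<close>, which should bound the
  conditional probability of \<open>V\<close> at \<open>\<tau>\<close> by that of \<open>A\<close> plus \<open>\<eta>\<close>. As \<open>\<phi>\<close> is known only for each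
  deterministic level, up to null sets, the comparison is made for a fixed level \<open>t\<close> on the event
  \<open>\<tau> \<le> t\<close>, which belongs to the conditioning algebra; the levels with \<open>\<phi> t > a + \<eta>\<close> form a
  down-set, and countably many of them suffice to exclude all of it.\<close>

lemma (in prob_space) conditional_tail_transfer:
  fixes \<tau> :: "'a \<Rightarrow> real" and \<phi> :: "real \<Rightarrow> real"
  assumes sub: "subalgebra M F"
    and \<tau>[measurable]: "\<tau> \<in> borel_measurable F"
    and V: "\<And>t. V t \<in> events" "antimono V"
    and cond_V: "\<And>t. AE \<omega> in M. real_cond_exp M F (indicator (V t)) \<omega> = \<phi> t"
    and A: "A \<in> events" "AE \<omega> in M. real_cond_exp M F (indicator A) \<omega> = a"
    and N: "N \<in> events" "\<And>\<omega>. \<omega> \<in> N \<Longrightarrow> \<omega> \<in> V (\<tau> \<omega>) \<Longrightarrow> \<omega> \<in> A"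
  shows "AE \<omega> in M. real_cond_exp M F (indicator N) \<omega> \<ge> 1 - \<eta> \<longrightarrow> \<phi> (\<tau> \<omega>) \<le> a + \<eta>"
proof -
  interpret finite_measure_subalgebra M F by unfold_locales (rule sub)
  note [measurable] = V(1) A(1) N(1)
  have int: "integrable M (indicator S :: 'a \<Rightarrow> real)" if "S \<in> events" for S
    using that by (simp add: emeasure_eq_measure)
  have cond1: "AE \<omega> in M. real_cond_exp M F (\<lambda>_. 1) \<omega> = 1"
    by (rule real_cond_exp_F_meas) auto
  have pointwise: "AE \<omega> in M. real_cond_exp M F (indicator N) \<omega> \<ge> 1 - \<eta> \<and> \<tau> \<omega> \<le> t
      \<longrightarrow> \<phi> t \<le> a + \<eta>" for t
  proof -
    define I :: "'a \<Rightarrow> real" where "I \<omega> = indicator {..t} (\<tau> \<omega>)" for \<omega>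
    have I[measurable]: "I \<in> borel_measurable F" unfolding I_def by measurable
    have I_M[measurable]: "I \<in> borel_measurable M"
      using I by (rule measurable_from_subalg[OF sub])
    have intI: "integrable M (\<lambda>\<omega>. I \<omega> * indicator (V t) \<omega>)"
    proof (rule integrable_const_bound[of _ 1])
      show "AE \<omega> in M. norm (I \<omega> * indicator (V t) \<omega>) \<le> 1"
        by (auto simp: I_def indicator_def)
    qed measurable
    have le: "I \<omega> * indicator (V t) \<omega> \<le> indicator A \<omega> + (1 - indicator N \<omega>)" for \<omega>
    proof -
      have "\<omega> \<in> A" if "\<omega> \<in> N" "\<omega> \<in> V t" "\<tau> \<omega> \<le> t"
        using N(2) that antimonoD[OF V(2) that(3)] by blast
      then show ?thesis by (auto simp: I_def indicator_def)
    qed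
    have "AE \<omega> in M. real_cond_exp M F (\<lambda>\<omega>. I \<omega> * indicator (V t) \<omega>) \<omega> =
        I \<omega> * real_cond_exp M F (indicator (V t)) \<omega>"
      by (rule real_cond_exp_mult) (use intI in auto)
    moreover have "AE \<omega> in M. real_cond_exp M F (\<lambda>\<omega>. I \<omega> * indicator (V t) \<omega>) \<omega> \<le>
        real_cond_exp M F (\<lambda>\<omega>. indicator A \<omega> + (1 - indicator N \<omega>)) \<omega>"
      by (rule real_cond_exp_mono) (use le intI int[OF A(1)] int[OF N(1)] in auto)
    moreover have "AE \<omega> in M. real_cond_exp M F (\<lambda>\<omega>. indicator A \<omega> + (1 - indicator N \<omega>)) \<omega> =
        real_cond_exp M F (indicator A) \<omega> + real_cond_exp M F (\<lambda>\<omega>. 1 - indicator N \<omega>) \<omega>"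
      by (rule real_cond_exp_add) (use int[OF A(1)] int[OF N(1)] in auto)
    moreover have "AE \<omega> in M. real_cond_exp M F (\<lambda>\<omega>. 1 - indicator N \<omega>) \<omega> =
        real_cond_exp M F (\<lambda>\<omega>. 1) \<omega> - real_cond_exp M F (indicator N) \<omega>"
      by (rule real_cond_exp_diff) (use int[OF N(1)] in auto)
    ultimately show ?thesis using cond1 cond_V[of t] A(2)
      by eventually_elim (auto simp: I_def)
  qed
  have \<phi>_anti: "\<phi> t \<le> \<phi> s" if "s \<le> t" for s t
  proof -
    have "AE \<omega> in M. real_cond_exp M F (indicator (V t)) \<omega> \<le> real_cond_exp M F (indicator (V s)) \<omega>"
      using antimonoD[OF V(2) that] int V(1)
      by (intro real_cond_exp_mono) (auto simp: indicator_def)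
    with cond_V[of s] cond_V[of t] have "AE \<omega> in M. \<phi> t \<le> \<phi> s" by eventually_elim simp
    then show ?thesis by simp
  qed
  define U where "U = {t. \<phi> t > a + \<eta>}"
  show ?thesis
  proof (cases "U = {}")
    case True
    then have "\<phi> t \<le> a + \<eta>" for t by (auto simp: U_def not_less)
    then show ?thesis by simp
  next
    case False
    then obtain t :: "nat \<Rightarrow> real" where t: "U = (\<Union>m. {..t m})"
      by (rule down_set_exhaustion)
         (use \<phi>_anti in \<open>auto simp: U_def intro: less_le_trans\<close>)
    have "AE \<omega> in M. \<forall>m. \<not> (real_cond_exp M F (indicator N) \<omega> \<ge> 1 - \<eta> \<and> \<tau> \<omega> \<le> t m)"
    proof (subst AE_all_countable, intro allI)
      fix m
      have "t m \<in> U" using t by auto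
      then have "\<not> \<phi> (t m) \<le> a + \<eta>" by (simp add: U_def)
      then show "AE \<omega> in M. \<not> (real_cond_exp M F (indicator N) \<omega> \<ge> 1 - \<eta> \<and> \<tau> \<omega> \<le> t m)"
        using pointwise[of "t m"] by simp
    qed
    then show ?thesis
    proof eventually_elim
      case (elim \<omega>)
      then have "1 - \<eta> \<le> real_cond_exp M F (indicator N) \<omega> \<longrightarrow> \<tau> \<omega> \<notin> U" using t by auto
      then show ?case by (auto simp: U_def)
    qed
  qed
qed

lemma (in prob_space) prob_Int3_ge:
  assumes "E1 \<in> events" "E2 \<in> events" "E3 \<in> events" "H \<in> events"
    and "AE \<omega> in M. \<omega> \<in> E1 \<longrightarrow> \<omega> \<in> E2 \<longrightarrow> \<omega> \<in> E3 \<longrightarrow> \<omega> \<in> H"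
  shows "prob H \<ge> prob E1 + prob E2 + prob E3 - 2"
proof -
  have "prob (space M - H) \<le> prob ((space M - E1) \<union> (space M - E2) \<union> (space M - E3))"
    using assms by (intro finite_measure_mono_AE) auto
  also have "\<dots> \<le> prob (space M - E1) + prob (space M - E2) + prob (space M - E3)"
    using assms(1-3) by (intro order_trans[OF measure_Un_le] add_right_mono measure_Un_le) auto
  finally show ?thesis using assms(1-4) by (simp add: prob_compl)
qed

section \<open>Borel sets of a separable Hilbert space\<close>

lemma dense_sequence:
  obtains d :: "nat \<Rightarrow> 'a::second_countable_topology"
  where "\<And>U. open U \<Longrightarrow> U \<noteq> {} \<Longrightarrow> \<exists>n. d n \<in> U"
proof -
  obtain D :: "'a set" where D: "countable D" "\<And>U. open U \<Longrightarrow> U \<noteq> {} \<Longrightarrow> \<exists>d\<in>D. d \<in> U"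
    by (rule countable_dense_setE) blast
  then have "D \<noteq> {}" by (metis empty_iff open_UNIV UNIV_not_empty)
  then have "D = range (from_nat_into D)" using D(1) by (simp add: range_from_nat_into)
  then show thesis using that[of "from_nat_into D"] D(2) by (metis rangeE)
qed

text \<open>A closed ball is a countable intersection of half-spaces. By continuity the inequality extends
  from the dense sequence to every vector, in particular to \<open>z\<close> itself.\<close>

lemma norm_le_iff_inner_le_on_dense:
  fixes z :: "'h::real_inner"
  assumes dense: "\<And>U. open U \<Longrightarrow> U \<noteq> {} \<Longrightarrow> \<exists>n. d n \<in> U" and t: "0 \<le> t"
  shows "norm z \<le> t \<longleftrightarrow> (\<forall>n. inner (d n) z \<le> t * norm (d n))"
proof
  assume z: "norm z \<le> t"
  have "inner u z \<le> t * norm u" for u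
    using norm_cauchy_schwarz[of u z] mult_right_mono[OF z norm_ge_zero[of u]]
    by (simp add: mult.commute)
  then show "\<forall>n. inner (d n) z \<le> t * norm (d n)" by blast
next
  assume *: "\<forall>n. inner (d n) z \<le> t * norm (d n)"
  have "open {u. inner u z > t * norm u}"
    by (intro open_Collect_less continuous_intros)
  from dense[OF this] * have "{u. inner u z > t * norm u} = {}"
    by (metis (mono_tags, lifting) mem_Collect_eq not_less)
  then have "inner z z \<le> t * norm z" by (simp add: not_less Collect_empty_eq)
  then show "norm z \<le> t"
    using t by (cases "z = 0") (auto simp: power2_norm_eq_inner[symmetric] power2_eq_square)
qed

text \<open>Pettis' theorem: weak and strong measurability agree in the separable case, since balls are
  countable intersections of half-spaces and open sets are countable unions of balls.\<close>

lemma borel_measurable_if_inner_measurable: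
  fixes f :: "'a \<Rightarrow> 'h::{real_inner, second_countable_topology}"
  assumes meas: "\<And>u. (\<lambda>\<omega>. inner u (f \<omega>)) \<in> borel_measurable M"
  shows "f \<in> borel_measurable M"
proof (rule borel_measurableI)
  fix U :: "'h set"
  assume U: "open U"
  obtain d :: "nat \<Rightarrow> 'h" where d: "\<And>U. open U \<Longrightarrow> U \<noteq> {} \<Longrightarrow> \<exists>n. d n \<in> U"
    by (rule dense_sequence) blast
  have cballs: "f -` cball c r \<inter> space M \<in> sets M" if r: "r > 0" for c r
  proof -
    have "f -` cball c r \<inter> space M =
        {\<omega>\<in>space M. \<forall>n. inner (d n) (f \<omega>) \<le> r * norm (d n) + inner (d n) c}"
      using norm_le_iff_inner_le_on_dense[OF d, of r "f _ - c"] r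
      by (auto simp: dist_norm norm_minus_commute inner_diff_right algebra_simps)
    also have "\<dots> \<in> sets M"
    proof (rule sets.sets_Collect_countable_All)
      fix n
      note [measurable] = meas[of "d n"]
      show "{\<omega>\<in>space M. inner (d n) (f \<omega>) \<le> r * norm (d n) + inner (d n) c} \<in> sets M"
        by measurable
    qed
    finally show ?thesis .
  qed
  define I where "I = {(n, q). q \<in> \<rat> \<and> 0 < q \<and> cball (d n) q \<subseteq> U}"
  have "countable I"
    by (rule countable_subset[of _ "UNIV \<times> \<rat>"]) (auto simp: I_def countable_rat)
  have "U = (\<Union>(n, q)\<in>I. cball (d n) q)"
  proof (intro equalityI subsetI)
    fix x assume "x \<in> U"
    then obtain e where e: "e > 0" "ball x e \<subseteq> U" using U openE by blast
    obtain q where q: "q \<in> \<rat>" "e / 4 < q" "q < e / 2"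
      using Rats_dense_in_real[of "e / 4" "e / 2"] e by auto
    obtain n where n: "d n \<in> ball x q" using d[of "ball x q"] q e by fastforce
    have "cball (d n) q \<subseteq> ball x e"
    proof
      fix y assume "y \<in> cball (d n) q"
      then have "dist x y \<le> dist x (d n) + q" using dist_triangle[of x y "d n"] by simp
      then show "y \<in> ball x e" using n q(3) by simp
    qed
    then have "(n, q) \<in> I" using q e by (auto simp: I_def)
    moreover have "x \<in> cball (d n) q" using n by (simp add: dist_commute)
    ultimately show "x \<in> (\<Union>(n, q)\<in>I. cball (d n) q)" by blast
  qed (auto simp: I_def)
  then have "f -` U \<inter> space M = (\<Union>i\<in>I. f -` (case i of (n, q) \<Rightarrow> cball (d n) q) \<inter> space M)"
    by blast
  also have "\<dots> \<in> sets M"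
    using \<open>countable I\<close> cballs by (intro sets.countable_UN'') (auto simp: I_def)
  finally show "f -` U \<inter> space M \<in> sets M" .
qed

section \<open>The law of the norm is determined by one-dimensional projections\<close>

text \<open>Levy's uniqueness theorem holds for finite measures by normalising; the value at 0 is the total
  mass, so both measures are divided by the same constant.\<close>

lemma finite_measure_char_unique:
  fixes \<mu> \<nu> :: "real measure"
  assumes \<mu>: "finite_measure \<mu>" "sets \<mu> = sets borel"
    and \<nu>: "finite_measure \<nu>" "sets \<nu> = sets borel"
    and char: "char \<mu> = char \<nu>"
  shows "\<mu> = \<nu>"
proof -
  have space: "space \<mu> = UNIV" "space \<nu> = UNIV"
    using sets_eq_imp_space_eq[OF \<mu>(2)] sets_eq_imp_space_eq[OF \<nu>(2)] by simp_all
  define m where "m = measure \<mu> UNIV"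
  have "complex_of_real (measure \<mu> UNIV) = complex_of_real (measure \<nu> UNIV)"
    using fun_cong[OF char, of 0] space by (simp add: char_def)
  then have m: "measure \<mu> UNIV = m" "measure \<nu> UNIV = m"
    unfolding m_def by (metis of_real_eq_iff)+
  define ok where "ok \<rho> \<longleftrightarrow> finite_measure \<rho> \<and> sets \<rho> = sets borel \<and> measure \<rho> UNIV = m"
    for \<rho> :: "real measure"
  have ok: "ok \<mu>" "ok \<nu>" using \<mu> \<nu> m by (simp_all only: ok_def)
  have total: "emeasure \<rho> UNIV = ennreal m" if "ok \<rho>" for \<rho>
    using that unfolding ok_def by (metis finite_measure.emeasure_eq_measure)
  show ?thesis
  proof (cases "m = 0")
    case True
    have null: "emeasure \<rho> A = 0" if "ok \<rho>" for \<rho> A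
    proof -
      have "emeasure \<rho> A \<le> emeasure \<rho> (space \<rho>)" by (rule emeasure_space)
      also have "\<dots> \<le> emeasure \<rho> UNIV"
        using that by (intro emeasure_mono) (simp_all add: ok_def)
      also have "\<dots> = 0" using total[OF that] True by simp
      finally show ?thesis by simp
    qed
    show ?thesis
      using null[OF ok(1)] null[OF ok(2)] \<mu>(2) \<nu>(2) by (intro measure_eqI) simp_all
  next
    case False
    then have "m > 0" using m_def measure_nonneg[of \<mu> UNIV] by linarith
    then have inv_m: "ennreal (1 / m) * ennreal m = 1"
      by (subst ennreal_mult[symmetric]) simp_all
    define normalise where "normalise \<rho> = density \<rho> (\<lambda>_. ennreal (1 / m))" for \<rho> :: "real measure"
    have em: "emeasure (normalise \<rho>) A = ennreal (1 / m) * emeasure \<rho> A" if "A \<in> sets \<rho>" for \<rho> A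
      unfolding normalise_def using that
      by (subst emeasure_density) (simp_all add: nn_integral_cmult_indicator)
    have real: "real_distribution (normalise \<rho>)" if "ok \<rho>" for \<rho>
    proof (intro real_distribution.intro real_distribution_axioms.intro prob_spaceI)
      show s: "sets (normalise \<rho>) = sets borel"
        using that by (simp add: ok_def normalise_def)
      have sp: "space (normalise \<rho>) = UNIV" using sets_eq_imp_space_eq[OF s] by simp
      have "UNIV \<in> sets \<rho>" using that by (simp add: ok_def)
      then show "emeasure (normalise \<rho>) (space (normalise \<rho>)) = 1"
        unfolding sp using em[of UNIV \<rho>] total[OF that] inv_m by simp
    qed
    have char_norm: "char (normalise \<rho>) t = complex_of_real (1 / m) * char \<rho> t" if "ok \<rho>" for \<rho> t
    proof -
      have [measurable_cong]: "sets \<rho> = sets borel" using that by (simp add: ok_def)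
      have "char (normalise \<rho>) t = (CLINT x|\<rho>. (1 / m) *\<^sub>R iexp (t * x))"
        unfolding normalise_def char_def using \<open>m > 0\<close>
        by (intro integral_density) simp_all
      then show ?thesis
        unfolding char_def integral_scaleR_right by (simp only: scaleR_conv_of_real)
    qed
    have "char (normalise \<mu>) = char (normalise \<nu>)"
      using char by (intro ext) (simp only: char_norm[OF ok(1)] char_norm[OF ok(2)])
    from Levy_uniqueness[OF real[OF ok(1)] real[OF ok(2)] this]
    have norm_eq: "normalise \<mu> = normalise \<nu>" .
    show ?thesis
    proof (rule measure_eqI)
      fix A assume A: "A \<in> sets \<mu>"
      have "ennreal (1 / m) * emeasure \<mu> A = ennreal (1 / m) * emeasure \<nu> A"
        using em[of A \<mu>] em[of A \<nu>] A \<mu>(2) \<nu>(2) norm_eq by simp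
      then have "ennreal m * ennreal (1 / m) * emeasure \<mu> A = ennreal m * ennreal (1 / m) * emeasure \<nu> A"
        by (simp only: mult.assoc)
      then show "emeasure \<mu> A = emeasure \<nu> A"
        using inv_m by (simp add: mult.commute[of "ennreal m"])
    qed (use \<mu>(2) \<nu>(2) in simp)
  qed
qed

text \<open>The uniqueness theorem applied to the image under \<open>X\<close> of the measure with density \<open>w\<close>. The
  weight carries the information on the coordinates that have been treated already, which is
  how one-dimensional uniqueness gives joint laws.\<close>

lemma weighted_projection_unique:
  fixes N1 N2 :: "'b measure" and X w :: "'b \<Rightarrow> real"
  assumes N: "finite_measure N1" "finite_measure N2" "sets N1 = sets N2"
    and X[measurable]: "X \<in> borel_measurable N1"
    and w[measurable]: "w \<in> borel_measurable N1" and w0: "\<And>z. 0 \<le> w z" and wb: "\<And>z. w z \<le> b"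
    and eq: "\<And>a. (CLINT z|N1. w z *\<^sub>R iexp (a * X z)) = (CLINT z|N2. w z *\<^sub>R iexp (a * X z))"
    and A[measurable]: "A \<in> sets borel"
  shows "(LINT z|N1. w z * indicator A (X z)) = (LINT z|N2. w z * indicator A (X z))"
proof -
  have X2[measurable]: "X \<in> borel_measurable N2" and w2[measurable]: "w \<in> borel_measurable N2"
    using X w by (simp_all cong: measurable_cong_sets add: N(3))
  define \<mu> where "\<mu> N = distr (density N (\<lambda>z. ennreal (w z))) borel X" for N
  have fin: "finite_measure (\<mu> N)"
    if "finite_measure N" and [measurable]: "X \<in> borel_measurable N" "w \<in> borel_measurable N" for N
  proof -
    interpret finite_measure N by fact
    have "(\<integral>\<^sup>+z. ennreal (w z) \<partial>N) \<le> (\<integral>\<^sup>+z. ennreal b \<partial>N)"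
      using wb by (intro nn_integral_mono ennreal_leI)
    also have "\<dots> < \<infinity>"
      by (simp add: emeasure_eq_measure ennreal_mult_less_top)
    finally have "finite_measure (density N (\<lambda>z. ennreal (w z)))"
      by (intro finite_measureI) (simp add: emeasure_density)
    then show ?thesis unfolding \<mu>_def by (rule finite_measure.finite_measure_distr) simp
  qed
  have char: "char (\<mu> N) a = (CLINT z|N. w z *\<^sub>R iexp (a * X z))"
    if [measurable]: "X \<in> borel_measurable N" "w \<in> borel_measurable N" for N a
    unfolding char_def \<mu>_def using w0 by (subst integral_distr) (auto simp: integral_density)
  have meas: "measure (\<mu> N) A = (LINT z|N. w z * indicator A (X z))"
    if [measurable]: "X \<in> borel_measurable N" "w \<in> borel_measurable N" for N
  proof -
    have "measure (\<mu> N) A = (LINT x|\<mu> N. indicator A x)"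
      by (simp add: \<mu>_def)
    also have "\<dots> = (LINT z|N. w z * indicator A (X z))"
      unfolding \<mu>_def using w0 by (subst integral_distr) (auto simp: integral_density)
    finally show ?thesis .
  qed
  have "char (\<mu> N1) = char (\<mu> N2)"
    by (rule ext) (simp only: char[OF X w] char[OF X2 w2] eq)
  then have "\<mu> N1 = \<mu> N2"
    by (intro finite_measure_char_unique fin N X w X2 w2) (simp_all add: \<mu>_def)
  then show ?thesis using meas[OF X w] meas[OF X2 w2] by simp
qed

text \<open>The indicators of the sets \<open>A i\<close> are introduced one coordinate at a time, while the Fourier
  factor \<open>iexp (inner u z)\<close> for every \<open>u\<close> is kept as the inductive invariant. For the next
  coordinate the weight would have to be \<open>g z * iexp (inner u z)\<close>, which is complex, whereas
  uniqueness needs a nonnegative weight. It is therefore applied to \<open>g\<close> times \<open>1 + cos\<close>,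
  \<open>1 + sin\<close> and \<open>1\<close>: the transforms of these are combinations of the transforms known by
  induction at the frequencies shifted by \<open>u\<close> and \<open>- u\<close>, and the differences give back the real and
  imaginary part of the Fourier factor.\<close>

lemma cylinder_transform_unique:
  fixes N1 N2 :: "'h::{real_inner, second_countable_topology} measure"
    and e :: "nat \<Rightarrow> 'h" and A :: "nat \<Rightarrow> real set"
  assumes N: "prob_space N1" "prob_space N2" "sets N1 = sets borel" "sets N2 = sets borel"
    and proj: "\<And>u. distr N1 borel (inner u) = distr N2 borel (inner u)"
    and A[measurable]: "\<And>i. A i \<in> sets borel"
  shows "(CLINT z|N1. (\<Prod>i<m. indicator (A i) (inner (e i) z)) *\<^sub>R iexp (inner u z)) =
    (CLINT z|N2. (\<Prod>i<m. indicator (A i) (inner (e i) z)) *\<^sub>R iexp (inner u z))"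
proof (induction m arbitrary: u)
  case 0
  note [measurable_cong] = N(3,4)
  have *: "(CLINT z|N. iexp (inner u z)) = char (distr N borel (inner u)) 1"
    if [measurable_cong]: "sets N = sets borel" for N
    unfolding char_def by (subst integral_distr) auto
  show ?case using *[of N1] *[of N2] N proj[of u] by simp
next
  case (Suc m)
  note [measurable_cong] = N(3,4)
  interpret N1: prob_space N1 by fact
  interpret N2: prob_space N2 by fact
  define g :: "'h \<Rightarrow> real" where "g z = (\<Prod>i<m. indicator (A i) (inner (e i) z))" for z
  have g[measurable]: "g \<in> borel_measurable borel" unfolding g_def by measurable
  have g01: "0 \<le> g z" "g z \<le> 1" for z
    unfolding g_def by (auto intro!: prod_nonneg prod_le_1)
  \<comment> \<open>The cases \<open>p = 0\<close>, \<open>p = 1/2\<close> and \<open>p = - \<i>/2\<close> are 1, \<open>1 + cos y\<close> and \<open>1 + sin y\<close>.\<close>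
  define \<psi> where "\<psi> p y = 1 + 2 * Re (p * iexp y)" for p :: complex and y
  have \<psi>_eq: "complex_of_real (\<psi> p y) = 1 + p * iexp y + cnj p * iexp (- y)" for p y
    by (simp add: complex_eq_iff \<psi>_def Re_exp Im_exp)
  have \<psi>_bound: "0 \<le> \<psi> p y" "\<psi> p y \<le> 2" if "norm p \<le> 1 / 2" for p y
  proof -
    have "\<bar>Re (p * iexp y)\<bar> \<le> norm (p * iexp y)" by (rule abs_Re_le_cmod)
    also have "\<dots> \<le> 1 / 2" using that by (simp add: norm_mult)
    finally show "0 \<le> \<psi> p y" "\<psi> p y \<le> 2" unfolding \<psi>_def by linarith+
  qed
  have \<psi>[measurable]: "\<psi> p \<in> borel_measurable borel" for p
    unfolding \<psi>_def by measurable
  define J where "J N v = (CLINT z|N. g z *\<^sub>R iexp (inner v z))" for N v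
  have int: "integrable N (\<lambda>z. g z *\<^sub>R iexp (inner v z))"
    if "prob_space N" and [measurable_cong]: "sets N = sets borel" for N v
  proof -
    interpret prob_space N by fact
    show ?thesis by (rule integrable_const_bound[of _ 1]) (use g01 in auto)
  qed
  have expand: "(CLINT z|N. (g z * \<psi> p (inner u z)) *\<^sub>R iexp (a * inner (e m) z)) =
      J N (a *\<^sub>R e m) + p * J N (a *\<^sub>R e m + u) + cnj p * J N (a *\<^sub>R e m - u)"
    if N: "prob_space N" "sets N = sets borel" for N p a
  proof -
    have lin: "(CLINT z|N. f1 z + p * f2 z + cnj p * f3 z) =
        (CLINT z|N. f1 z) + p * (CLINT z|N. f2 z) + cnj p * (CLINT z|N. f3 z)"
      if "integrable N f1" "integrable N f2" "integrable N f3" for f1 f2 f3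
      using that by simp
    have "(CLINT z|N. (g z * \<psi> p (inner u z)) *\<^sub>R iexp (a * inner (e m) z)) =
        (CLINT z|N. g z *\<^sub>R iexp (inner (a *\<^sub>R e m) z) +
          p * (g z *\<^sub>R iexp (inner (a *\<^sub>R e m + u) z)) +
          cnj p * (g z *\<^sub>R iexp (inner (a *\<^sub>R e m - u) z)))"
      by (intro Bochner_Integration.integral_cong refl)
        (simp add: scaleR_conv_of_real \<psi>_eq inner_add_left inner_diff_left algebra_simps
          exp_add exp_diff exp_minus field_simps)
    also have "\<dots> = (CLINT z|N. g z *\<^sub>R iexp (inner (a *\<^sub>R e m) z)) +
        p * (CLINT z|N. g z *\<^sub>R iexp (inner (a *\<^sub>R e m + u) z)) +
        cnj p * (CLINT z|N. g z *\<^sub>R iexp (inner (a *\<^sub>R e m - u) z))"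
      by (rule lin[OF int[OF N] int[OF N] int[OF N]])
    finally show ?thesis unfolding J_def .
  qed
  have key: "(LINT z|N1. (g z * \<psi> p (inner u z)) * indicator (A m) (inner (e m) z)) =
      (LINT z|N2. (g z * \<psi> p (inner u z)) * indicator (A m) (inner (e m) z))"
    if p: "norm p \<le> 1 / 2" for p
  proof (rule weighted_projection_unique[where b = 2])
    show "(CLINT z|N1. (g z * \<psi> p (inner u z)) *\<^sub>R iexp (a * inner (e m) z)) =
        (CLINT z|N2. (g z * \<psi> p (inner u z)) *\<^sub>R iexp (a * inner (e m) z))" for a
      unfolding expand[OF N(1,3)] expand[OF N(2,4)] unfolding J_def g_def by (simp only: Suc.IH)
    show "0 \<le> g z * \<psi> p (inner u z)" for z using g01 \<psi>_bound[OF p] by simp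
    show "g z * \<psi> p (inner u z) \<le> 2" for z
      using mult_mono[of "g z" 1 "\<psi> p (inner u z)" 2] g01 \<psi>_bound[OF p] by simp
  qed (use N N1.finite_measure_axioms N2.finite_measure_axioms in auto)
  have split: "(CLINT z|N. (\<Prod>i<Suc m. indicator (A i) (inner (e i) z)) *\<^sub>R iexp (inner u z)) =
     complex_of_real ((LINT z|N. (g z * \<psi> (1/2) (inner u z)) * indicator (A m) (inner (e m) z)) -
       (LINT z|N. (g z * \<psi> 0 (inner u z)) * indicator (A m) (inner (e m) z))) +
     \<i> * complex_of_real ((LINT z|N. (g z * \<psi> (- \<i>/2) (inner u z)) * indicator (A m) (inner (e m) z)) -
       (LINT z|N. (g z * \<psi> 0 (inner u z)) * indicator (A m) (inner (e m) z)))"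
    if N: "prob_space N" and [measurable_cong]: "sets N = sets borel" for N
  proof -
    interpret prob_space N by fact
    have i: "integrable N (\<lambda>z. (g z * \<psi> p (inner u z)) * indicator (A m) (inner (e m) z))"
      if "norm p \<le> 1 / 2" for p
    proof (rule integrable_const_bound[of _ 2])
      have "norm (g z * \<psi> p (inner u z) * indicator (A m) (inner (e m) z)) \<le> 1 * 2 * 1" for z
        unfolding norm_mult using g01[of z] \<psi>_bound[OF that, of "inner u z"]
        by (intro mult_mono) auto
      then show "AE z in N. norm (g z * \<psi> p (inner u z) * indicator (A m) (inner (e m) z)) \<le> 2"
        by simp
    qed measurable
    have c: "complex_of_real (g z * \<psi> (1/2) (inner u z) * indicator (A m) (inner (e m) z)) -
        complex_of_real (g z * \<psi> 0 (inner u z) * indicator (A m) (inner (e m) z)) +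
       \<i> * (complex_of_real (g z * \<psi> (- \<i>/2) (inner u z) * indicator (A m) (inner (e m) z)) -
        complex_of_real (g z * \<psi> 0 (inner u z) * indicator (A m) (inner (e m) z))) =
       (\<Prod>i<Suc m. indicator (A i) (inner (e i) z)) *\<^sub>R iexp (inner u z)" for z
      by (simp add: g_def \<psi>_def scaleR_conv_of_real complex_eq_iff Re_exp Im_exp algebra_simps)
    have j: "integrable N (\<lambda>z. complex_of_real (g z * \<psi> p (inner u z) * indicator (A m) (inner (e m) z)))"
      if "norm p \<le> 1 / 2" for p using i[OF that] by (rule integrable_of_real)
    show ?thesis
      unfolding c[symmetric] of_real_diff integral_complex_of_real[symmetric]
      using j[of 0] j[of "1/2"] j[of "-\<i>/2"]
      by (simp add: norm_divide del: of_real_mult)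
  qed
  show ?case
    unfolding split[OF N(1,3)] split[OF N(2,4)]
    using key[of 0] key[of "1/2"] key[of "-\<i>/2"] by (simp add: norm_divide)
qed

lemma norm_law_unique_if_projections_eq:
  fixes N1 N2 :: "'h::{real_inner, second_countable_topology} measure"
  assumes N: "prob_space N1" "prob_space N2" "sets N1 = sets borel" "sets N2 = sets borel"
    and proj: "\<And>u. distr N1 borel (inner u) = distr N2 borel (inner u)"
  shows "measure N1 {z. norm z \<le> t} = measure N2 {z. norm z \<le> t}"
proof (cases "0 \<le> t")
  case False
  then have "{z :: 'h. norm z \<le> t} = {}" using norm_ge_zero order_trans by blast
  then show ?thesis by simp
next
  case True
  obtain d :: "nat \<Rightarrow> 'h" where d: "\<And>U. open U \<Longrightarrow> U \<noteq> {} \<Longrightarrow> \<exists>n. d n \<in> U"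
    by (rule dense_sequence) blast
  define C where "C m = {z. \<forall>i<m. inner (d i) z \<le> t * norm (d i)}" for m :: nat
  have ball: "{z. norm z \<le> t} = (\<Inter>m. C m)"
    using norm_le_iff_inner_le_on_dense[OF d True] by (auto simp: C_def)
  \<comment> \<open>The trivial factor \<open>iexp (inner 0 z)\<close> brings the measure into the form to which uniqueness of
    cylinder transforms applies.\<close>
  have C_int: "complex_of_real (measure N (C m)) =
      (CLINT z|N. (\<Prod>i<m. indicator {..t * norm (d i)} (inner (d i) z)) *\<^sub>R iexp (inner 0 z))"
    if "prob_space N" "sets N = sets borel" for N m
  proof -
    interpret prob_space N by fact
    have sp: "space N = UNIV" using sets_eq_imp_space_eq[OF that(2)] by simp
    have "(\<Prod>i<m. indicator {..t * norm (d i)} (inner (d i) z)) = (indicator (C m) z :: real)" for z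
      by (induction m) (auto simp: C_def indicator_def less_Suc_eq)
    then show ?thesis by (simp add: sp scaleR_conv_of_real)
  qed
  have eq: "measure N1 (C m) = measure N2 (C m)" for m
  proof -
    define A where "A i = {..t * norm (d i)}" for i
    have A: "A i \<in> sets borel" for i by (simp add: A_def)
    have "complex_of_real (measure N1 (C m)) = complex_of_real (measure N2 (C m))"
      unfolding C_int[OF N(1,3)] C_int[OF N(2,4)] A_def[symmetric]
      by (intro cylinder_transform_unique N proj A)
    then show ?thesis by (simp only: of_real_eq_iff)
  qed
  have lim: "(\<lambda>m. measure N (C m)) \<longlonglongrightarrow> measure N {z. norm z \<le> t}"
    if "prob_space N" "sets N = sets borel" for N
  proof -
    interpret prob_space N by fact
    have "C m = (\<Inter>i<m. {z. inner (d i) z \<le> t * norm (d i)})" for m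
      by (auto simp: C_def)
    then have "closed (C m)" for m
      by (simp only:) (intro closed_INT ballI closed_Collect_le continuous_intros)
    then have "C m \<in> sets N" for m using that(2) by simp
    moreover have "decseq C"
    proof (intro decseq_SucI subsetI)
      show "z \<in> C m" if "z \<in> C (Suc m)" for m z using that by (simp add: C_def)
    qed
    ultimately show ?thesis
      unfolding ball by (intro finite_Lim_measure_decseq image_subsetI)
  qed
  show ?thesis
    using LIMSEQ_unique[OF lim[OF N(1,3)]] lim[OF N(2,4)] by (simp only: eq)
qed

lemma normal_law_second_moment: "(LINT x|normal_law s. x\<^sup>2) = s\<^sup>2" if "s \<ge> 0"
proof (cases "s = 0")
  case True
  then show ?thesis by (simp add: normal_law_def integral_return)
next
  case False
  then have "s > 0" using that by simp
  have "(LINT x|normal_law s. x\<^sup>2) = (LINT x|lborel. normal_density 0 s x * (x - 0) ^ (2 * 1))"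
    using False by (simp add: normal_law_def integral_density)
  also have "\<dots> = s\<^sup>2"
    using integral_normal_moment_even[OF \<open>s > 0\<close>, of 0 1] \<open>s > 0\<close> by (simp add: field_simps)
  finally show ?thesis .
qed

text \<open>The projection onto \<open>u\<close> is centered normal with variance \<open>inner u (C u)\<close>, so that \<open>C\<close> determines
  all projections.\<close>

lemma gaussian_norm_law_unique:
  assumes N1: "gaussian_with_cov N1 C" and N2: "gaussian_with_cov N2 C"
  shows "measure N1 {z. norm z \<le> t} = measure N2 {z. norm z \<le> t}"
proof (rule norm_law_unique_if_projections_eq)
  have proj: "distr N borel (inner u) = normal_law (sqrt (inner u (C u)))"
    if G: "gaussian_with_cov N C" for N u
  proof -
    have [measurable_cong]: "sets N = sets borel"
      using G by (simp add: gaussian_with_cov_def centered_gaussian_def)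
    have "\<exists>s\<ge>0. distr N borel (inner u) = normal_law s"
      using G by (simp add: gaussian_with_cov_def centered_gaussian_def)
    then obtain s where s: "s \<ge> 0" "distr N borel (inner u) = normal_law s" by blast
    have "s\<^sup>2 = (LINT x|distr N borel (inner u). x\<^sup>2)"
      using normal_law_second_moment[OF s(1)] s(2) by simp
    also have "\<dots> = (LINT z|N. inner u z * inner u z)"
      by (subst integral_distr) (auto simp: power2_eq_square)
    also have "\<dots> = inner u (C u)"
      using G by (simp add: gaussian_with_cov_def)
    finally have "sqrt (inner u (C u)) = s" using s(1) by (metis real_sqrt_unique)
    with s(2) show ?thesis by simp
  qed
  show "distr N1 borel (inner u) = distr N2 borel (inner u)" for u
    using proj[OF N1] proj[OF N2] by simp
qed (use N1 N2 in \<open>auto simp: gaussian_with_cov_def centered_gaussian_def\<close>)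

section \<open>Hilbert space tools\<close>

lemma norm_diff_scaleR_square:
  fixes x y :: "'h::real_inner"
  shows "(norm (x - s *\<^sub>R y))\<^sup>2 = (norm x)\<^sup>2 - 2 * s * inner y x + s\<^sup>2 * (norm y)\<^sup>2"
  unfolding power2_norm_eq_inner
  by (simp add: inner_diff_left inner_diff_right inner_commute[of x y] power2_eq_square algebra_simps)

text \<open>The projection theorem in the form needed for density arguments: the best approximation \<open>p\<close> of
  \<open>f\<close> in \<open>V\<close> exists because minimising sequences are Cauchy by the parallelogram identity, and the
  residual \<open>f - p\<close> is orthogonal to \<open>V\<close>.\<close>

lemma closed_subspace_eq_UNIV:
  fixes V :: "'h::{real_inner, banach} set"
  assumes V: "subspace V" "closed V" and orth: "\<And>g. (\<And>v. v \<in> V \<Longrightarrow> inner v g = 0) \<Longrightarrow> g = 0"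
  shows "V = UNIV"
proof -
  have "f \<in> V" for f
  proof -
    have ne: "V \<noteq> {}" using subspace_0[OF V(1)] by auto
    define m where "m = infdist f V"
    have m: "m \<ge> 0" "\<And>v. v \<in> V \<Longrightarrow> m \<le> norm (f - v)"
      using infdist_nonneg[of f V] infdist_le[of _ V f] by (auto simp: m_def dist_norm)
    have "\<exists>v\<in>V. norm (f - v) < m + 1 / real (Suc i)" for i
    proof (rule ccontr)
      assume "\<not> ?thesis"
      then have "m + 1 / real (Suc i) \<le> infdist f V"
        unfolding infdist_notempty[OF ne] using ne
        by (intro cINF_greatest) (auto simp: dist_norm not_less)
      then show False by (simp add: m_def)
    qed
    then obtain v where v: "\<And>i. v i \<in> V" "\<And>i. norm (f - v i) < m + 1 / real (Suc i)"
      by metis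
    have lim_dist: "(\<lambda>i. norm (f - v i)) \<longlonglongrightarrow> m"
    proof (rule tendsto_sandwich)
      show "\<forall>\<^sub>F i in sequentially. m \<le> norm (f - v i)"
        using m(2)[OF v(1)] by (intro always_eventually allI)
      show "\<forall>\<^sub>F i in sequentially. norm (f - v i) \<le> m + 1 / real (Suc i)"
        using less_imp_le[OF v(2)] by (intro always_eventually allI)
      show "(\<lambda>i. m + 1 / real (Suc i)) \<longlonglongrightarrow> m"
        using tendsto_add[OF tendsto_const LIMSEQ_inverse_real_of_nat, of m]
        by (simp add: inverse_eq_divide)
    qed simp
    have par: "(norm (v i - v j))\<^sup>2 \<le> 2 * (norm (f - v i))\<^sup>2 + 2 * (norm (f - v j))\<^sup>2 - 4 * m\<^sup>2"
      for i j
    proof -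
      have "(1/2) *\<^sub>R (v i + v j) \<in> V" using V(1) v(1) by (intro subspace_mul subspace_add)
      from m(2)[OF this] m(1) have "m\<^sup>2 \<le> (norm (f - (1/2) *\<^sub>R (v i + v j)))\<^sup>2" by (rule power_mono)
      moreover have "(norm (v i - v j))\<^sup>2 + 4 * (norm (f - (1/2) *\<^sub>R (v i + v j)))\<^sup>2 =
          2 * (norm (f - v i))\<^sup>2 + 2 * (norm (f - v j))\<^sup>2"
        by (simp add: power2_norm_eq_inner inner_diff_left inner_diff_right inner_add_left
            inner_add_right inner_commute algebra_simps)
      ultimately show ?thesis by linarith
    qed
    have "Cauchy v"
    proof (rule metric_CauchyI)
      fix e :: real assume "e > 0"
      have "(\<lambda>i. 2 * (norm (f - v i))\<^sup>2 - 2 * m\<^sup>2) \<longlonglongrightarrow> 2 * m\<^sup>2 - 2 * m\<^sup>2"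
        by (intro tendsto_intros lim_dist)
      then have "\<forall>\<^sub>F i in sequentially. 2 * (norm (f - v i))\<^sup>2 - 2 * m\<^sup>2 < e\<^sup>2 / 2"
        using \<open>e > 0\<close> by (intro order_tendstoD(2)) auto
      then obtain N where N: "\<And>i. i \<ge> N \<Longrightarrow> 2 * (norm (f - v i))\<^sup>2 - 2 * m\<^sup>2 < e\<^sup>2 / 2"
        by (auto simp: eventually_sequentially)
      have "dist (v i) (v j) < e" if "i \<ge> N" "j \<ge> N" for i j
      proof -
        have "(norm (v i - v j))\<^sup>2 < e\<^sup>2" using par[of i j] N[OF that(1)] N[OF that(2)] by linarith
        then show ?thesis using \<open>e > 0\<close> by (simp add: dist_norm power2_less_imp_less)
      qed
      then show "\<exists>N. \<forall>i\<ge>N. \<forall>j\<ge>N. dist (v i) (v j) < e" by blast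
    qed
    then obtain p where p: "v \<longlonglongrightarrow> p" using Cauchy_convergent_iff convergent_def by blast
    then have "p \<in> V" using V(2) v(1) by (meson closed_sequentially)
    have "(\<lambda>i. norm (f - v i)) \<longlonglongrightarrow> norm (f - p)" by (intro tendsto_intros p)
    then have mp: "norm (f - p) = m" using lim_dist LIMSEQ_unique by blast
    have "inner w (f - p) = 0" if w: "w \<in> V" for w
    proof (cases "w = 0")
      case False
      \<comment> \<open>the coefficient of the projection of the residual onto \<open>w\<close>, which would improve the
        approximation unless it vanishes\<close>
      define c where "c = inner w (f - p) / (norm w)\<^sup>2"
      have "p + c *\<^sub>R w \<in> V" using V(1) \<open>p \<in> V\<close> w by (intro subspace_mul subspace_add)
      from m(2)[OF this] m(1) have "m\<^sup>2 \<le> (norm ((f - p) - c *\<^sub>R w))\<^sup>2"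
        by (intro power_mono) (simp_all add: diff_diff_eq)
      also have "\<dots> = m\<^sup>2 - 2 * c * inner w (f - p) + c\<^sup>2 * (norm w)\<^sup>2"
        by (simp only: norm_diff_scaleR_square mp)
      also have "\<dots> = m\<^sup>2 - (inner w (f - p))\<^sup>2 / (norm w)\<^sup>2"
        using False by (simp add: c_def field_simps power2_eq_square)
      finally have "(inner w (f - p))\<^sup>2 / (norm w)\<^sup>2 \<le> 0" by simp
      then show ?thesis using False by (simp add: divide_le_0_iff)
    qed simp
    then have "f - p = 0" by (rule orth)
    then show ?thesis using \<open>p \<in> V\<close> by simp
  qed
  then show ?thesis by blast
qed

text \<open>The step size \<open>l / c\<^sup>2\<close> minimises the bound \<open>1 - 2 s l + s\<^sup>2 c\<^sup>2\<close> on the square of the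
  contraction factor of \<open>v - s A v\<close>. The explicit iteration from 0, and not only the existence of a
  solution, matters: it makes the solution a measurable function of the data.\<close>

lemma coercive_iteration_converges:
  fixes A :: "'h::{real_inner, banach} \<Rightarrow> 'h" and b :: 'h
  assumes A: "linear A" and bound: "\<And>v. norm (A v) \<le> c * norm v"
    and coercive: "\<And>v. l * (norm v)\<^sup>2 \<le> inner (A v) v" and l: "0 < l"
  obtains v where "A v = b" "(\<lambda>m. ((\<lambda>v. v - (l / c\<^sup>2) *\<^sub>R (A v - b)) ^^ m) 0) \<longlonglongrightarrow> v"
proof (cases "\<exists>u :: 'h. u \<noteq> 0")
  case False
  then have "u = w" for u w :: 'h by metis
  then have "(\<lambda>m. ((\<lambda>v. v - (l / c\<^sup>2) *\<^sub>R (A v - b)) ^^ m) 0) = (\<lambda>_. 0)" "A 0 = b" by blast+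
  then show thesis using that[of 0] by simp
next
  case True
  then obtain u :: 'h where u: "u \<noteq> 0" by blast
  have "l * (norm u)\<^sup>2 \<le> norm (A u) * norm u"
    using coercive[of u] norm_cauchy_schwarz[of "A u" u] by linarith
  also have "\<dots> \<le> c * norm u * norm u" using bound by (intro mult_right_mono) auto
  finally have "l \<le> c" using u by (simp add: power2_eq_square)
  with l have c: "0 < c" "l\<^sup>2 / c\<^sup>2 \<le> 1"  by (auto simp: divide_le_eq power_mono)
  define step where "step v = v - (l / c\<^sup>2) *\<^sub>R (A v - b)" for v
  define q where "q = sqrt (1 - l\<^sup>2 / c\<^sup>2)"
  have q: "0 \<le> q" "q < 1" using c l by (auto simp: q_def)
  have contr: "norm (step v - step w) \<le> q * norm (v - w)" for v w
  proof -
    define x where "x = v - w"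
    have "step v - step w = x - (l / c\<^sup>2) *\<^sub>R A x"
      by (simp add: step_def x_def linear_diff[OF A] algebra_simps)
    then have "(norm (step v - step w))\<^sup>2 =
        (norm x)\<^sup>2 - 2 * (l / c\<^sup>2) * inner (A x) x + (l / c\<^sup>2)\<^sup>2 * (norm (A x))\<^sup>2"
      by (simp only: norm_diff_scaleR_square)
    also have "\<dots> \<le> (norm x)\<^sup>2 - 2 * (l / c\<^sup>2) * (l * (norm x)\<^sup>2) + (l / c\<^sup>2)\<^sup>2 * (c * norm x)\<^sup>2"
    proof (intro add_mono diff_mono order_refl)
      show "2 * (l / c\<^sup>2) * (l * (norm x)\<^sup>2) \<le> 2 * (l / c\<^sup>2) * inner (A x) x"
        using l by (intro mult_left_mono coercive) simp
      show "(l / c\<^sup>2)\<^sup>2 * (norm (A x))\<^sup>2 \<le> (l / c\<^sup>2)\<^sup>2 * (c * norm x)\<^sup>2"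
        by (intro mult_left_mono power_mono bound) simp_all
    qed
    also have "\<dots> = (1 - l\<^sup>2 / c\<^sup>2) * (norm x)\<^sup>2"
      using c by (simp add: field_simps power2_eq_square)
    also have "\<dots> = (q * norm x)\<^sup>2" using c by (simp add: q_def power_mult_distrib)
    finally have "norm (step v - step w) \<le> q * norm x"
      by (rule power2_le_imp_le) (simp add: q)
    then show ?thesis by (simp only: x_def)
  qed
  then obtain v where v: "step v = v"
    using banach_fix_type[OF q, of step] by (auto simp: dist_norm)
  then have "A v = b" using l c by (simp add: step_def)
  moreover have "norm ((step ^^ m) 0 - v) \<le> q ^ m * norm v" for m
  proof (induction m)
    case (Suc m)
    have "norm ((step ^^ Suc m) 0 - v) = norm (step ((step ^^ m) 0) - step v)" using v by simp
    also have "\<dots> \<le> q * norm ((step ^^ m) 0 - v)" by (rule contr)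
    also have "\<dots> \<le> q * (q ^ m * norm v)" using Suc.IH q by (intro mult_left_mono)
    finally show ?case by simp
  qed simp
  then have "(\<lambda>m. (step ^^ m) 0 - v) \<longlonglongrightarrow> 0"
  proof (rule Lim_null_comparison[OF always_eventually[OF allI]])
    show "(\<lambda>m. q ^ m * norm v) \<longlonglongrightarrow> 0"
      using q by (intro tendsto_mult_left_zero LIMSEQ_realpow_zero)
  qed
  then have "(\<lambda>m. (step ^^ m) 0) \<longlonglongrightarrow> v" by (simp add: LIM_zero_iff)
  ultimately show thesis by (intro that) (simp_all add: step_def[abs_def])
qed

section \<open>Measurability of the kernel ridge regression estimator\<close>

lemma ksec_reproducing:
  assumes "rkhs k evl"
  shows "evl f x = inner f (ksec k evl x)" "evl (ksec k evl x) = k x"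
proof -
  from assms have inj: "inj evl" and ex: "\<exists>kx. evl kx = k x \<and> (\<forall>f. evl f x = inner f kx)"
    by (simp_all only: rkhs_def)
  from ex obtain kx where kx: "evl kx = k x" "\<And>f. evl f x = inner f kx" by blast
  have "ksec k evl x = kx" unfolding ksec_def kx(1)[symmetric] by (rule inv_f_f[OF inj])
  with kx show "evl f x = inner f (ksec k evl x)" "evl (ksec k evl x) = k x" by simp_all
qed

text \<open>The elements with a measurable function form a closed subspace that contains all kernel
  sections, and an element orthogonal to these is the zero function.\<close>

lemma evl_borel_measurable:
  fixes evl :: "'h::{real_inner, banach} \<Rightarrow> 's \<Rightarrow> real"
  assumes rkhs: "rkhs k evl" and k: "\<And>x. k x \<in> borel_measurable S"
  shows "evl f \<in> borel_measurable S"
proof -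
  note evl = ksec_reproducing[OF rkhs]
  define V where "V = {f. evl f \<in> borel_measurable S}"
  have "V = UNIV"
  proof (rule closed_subspace_eq_UNIV)
    have fun_eq: "evl (f + g) = (\<lambda>x. evl f x + evl g x)" "evl (c *\<^sub>R f) = (\<lambda>x. c * evl f x)"
      "evl 0 = (\<lambda>x. 0)" for f g c
      by (simp_all add: fun_eq_iff evl(1) inner_add_left)
    show "subspace V" by (rule subspaceI) (auto simp: V_def fun_eq)
    show "closed V"
      unfolding closed_sequential_limits
    proof (intro allI impI, elim conjE)
      fix v f assume v: "\<forall>n. v n \<in> V" "v \<longlonglongrightarrow> f"
      have "evl f \<in> borel_measurable S"
      proof (rule borel_measurable_LIMSEQ_real)
        show "(\<lambda>n. evl (v n) x) \<longlonglongrightarrow> evl f x" for x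
        proof -
          have "evl g x = inner g (ksec k evl x)" for g by (rule evl(1))
          then show ?thesis using tendsto_inner[OF v(2) tendsto_const] by presburger
        qed
      qed (use v(1) in \<open>auto simp: V_def\<close>)
      then show "f \<in> V" by (simp add: V_def)
    qed
    fix g assume g: "\<And>v. v \<in> V \<Longrightarrow> inner v g = 0"
    have "evl g = evl 0"
    proof
      fix x
      have "ksec k evl x \<in> V" using k by (simp add: V_def evl(2))
      from g[OF this] show "evl g x = evl 0 x" by (simp add: evl(1) inner_commute)
    qed
    moreover have inj: "inj evl" using rkhs by (simp only: rkhs_def)
    ultimately show "g = 0" using injD[OF inj, of g 0] by simp
  qed
  then show ?thesis by (auto simp: V_def)
qed

lemma ksec_borel_measurable:
  fixes evl :: "'h::{real_inner, banach, second_countable_topology} \<Rightarrow> 's \<Rightarrow> real"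
  assumes rkhs: "rkhs k evl" and k: "\<And>x. k x \<in> borel_measurable S"
  shows "ksec k evl \<in> borel_measurable S"
proof (rule borel_measurable_if_inner_measurable)
  fix u
  have "evl u = (\<lambda>x. inner u (ksec k evl x))" 
    by (intro ext ksec_reproducing(1)[OF rkhs])
  with evl_borel_measurable[OF rkhs k, of u]
  show "(\<lambda>x. inner u (ksec k evl x)) \<in> borel_measurable S" by (simp only:)
qed

text \<open>At a solution \<open>f\<close> of the normal equation the first-order term of the objective vanishes, so that
  the objective at \<open>g\<close> exceeds its value at \<open>f\<close> by at least \<open>lam * (norm (g - f))\<^sup>2\<close>. This
  makes \<open>f\<close> the unique minimiser, so that the choice in \<open>arg_min\<close> can only be \<open>f\<close>.\<close>

lemma krr_est_eqI:
  fixes evl :: "'h::{real_inner, banach} \<Rightarrow> 's \<Rightarrow> real"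
  assumes rkhs: "rkhs k evl" and lam: "lam > 0"
    and normal: "emp_cov_op n k evl x f + lam *\<^sub>R f = emp_mean n (\<lambda>i. y i *\<^sub>R ksec k evl (x i))"
  shows "krr_est n evl lam x y = f"
proof -
  define u where "u i = ksec k evl (x i)" for i
  have evl: "evl g (x i) = inner g (u i)" for g i
    unfolding u_def by (rule ksec_reproducing(1)[OF rkhs])
  define J where "J g = emp_mean n (\<lambda>i. (y i - evl g (x i))\<^sup>2) + lam * (norm g)\<^sup>2" for g
  have normal': "lam * inner f w = (1 / real n) * (\<Sum>i<n. (y i - inner f (u i)) * inner (u i) w)" for w
  proof -
    have "lam * inner f w =
        inner (emp_mean n (\<lambda>i. y i *\<^sub>R u i) - emp_cov_op n k evl x f) w"
      unfolding u_def normal[symmetric] by simp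
    also have "\<dots> = (1 / real n) * (\<Sum>i<n. (y i - inner f (u i)) * inner (u i) w)"
      by (simp add: emp_mean_def emp_cov_op_def tensor_def u_def inner_diff_left inner_sum_left
          inner_commute[of f] sum_subtractf left_diff_distrib right_diff_distrib diff_divide_distrib)
    finally show ?thesis .
  qed
  have diff: "J g = J f + (1 / real n) * (\<Sum>i<n. (inner (g - f) (u i))\<^sup>2) + lam * (norm (g - f))\<^sup>2" for g
  proof -
    define w where "w = g - f"
    have g: "g = f + w" by (simp add: w_def)
    define c where "c = (\<Sum>i<n. (y i - inner f (u i)) * inner (u i) w)"
    have "(\<Sum>i<n. (y i - inner g (u i))\<^sup>2) =
        (\<Sum>i<n. (y i - inner f (u i))\<^sup>2) - 2 * c + (\<Sum>i<n. (inner w (u i))\<^sup>2)"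
      by (simp add: g c_def sum_subtractf[symmetric] sum.distrib[symmetric] sum_distrib_left
          inner_add_left inner_commute[of w] power2_eq_square algebra_simps)
    moreover have "lam * (norm g)\<^sup>2 = lam * (norm f)\<^sup>2 + 2 * ((1 / real n) * c) + lam * (norm w)\<^sup>2"
      unfolding normal'[of w, folded c_def, symmetric]
      by (simp add: g power2_norm_eq_inner inner_add_left inner_add_right inner_commute algebra_simps)
    moreover have "J v = (1 / real n) * (\<Sum>i<n. (y i - inner v (u i))\<^sup>2) + lam * (norm v)\<^sup>2" for v
      by (simp add: J_def emp_mean_def evl)
    ultimately show ?thesis
      unfolding w_def[symmetric] by (simp only: distrib_left right_diff_distrib)
  qed
  have le: "J f + lam * (norm (g - f))\<^sup>2 \<le> J g" for g
    unfolding diff[of g] by (simp add: sum_nonneg)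
  have "is_arg_min J (\<lambda>_. True) g \<longleftrightarrow> g = f" for g
  proof
    assume "is_arg_min J (\<lambda>_. True) g"
    then have "J g \<le> J f" by (auto simp: is_arg_min_def not_less)
    then have "lam * (norm (g - f))\<^sup>2 \<le> 0" using le[of g] by linarith
    then show "g = f" using lam by (simp add: mult_le_0_iff)
  next
    assume "g = f"
    moreover have "J f \<le> J h" for h
      using le[of h] lam by (smt (verit) mult_nonneg_nonneg zero_le_power2)
    ultimately show "is_arg_min J (\<lambda>_. True) g" by (auto simp: is_arg_min_def not_less)
  qed
  then have "arg_min J (\<lambda>_. True) = f" by (simp add: arg_min_def)
  then show ?thesis unfolding krr_est_def J_def .
qed

text \<open>The operator \<open>A \<omega>\<close> of the normal equation has norm at most \<open>\<kappa>\<^sup>2 + lam\<close> and is coercive with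
  constant \<open>lam\<close>. The iteration therefore converges with the same step size for every sample, and
  each iterate is measurable because it is built from the data by finitely many measurable
  operations.\<close>

lemma krr_est_borel_measurable:
  fixes evl :: "'h::{real_inner, banach, second_countable_topology} \<Rightarrow> 's \<Rightarrow> real"
  assumes rkhs: "rkhs k evl" and k: "\<And>x. k x \<in> borel_measurable S" "\<And>x x'. k x x' \<le> \<kappa>\<^sup>2"
    and n: "n \<ge> 1" and lam: "lam > 0"
    and X: "\<And>i. i < n \<Longrightarrow> X i \<in> M \<rightarrow>\<^sub>M S" and Y: "\<And>i. i < n \<Longrightarrow> Y i \<in> borel_measurable M"
  shows "(\<lambda>\<omega>. krr_est n evl lam (\<lambda>i. X i \<omega>) (\<lambda>i. Y i \<omega>)) \<in> borel_measurable M"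
proof -
  define u where "u i \<omega> = ksec k evl (X i \<omega>)" for i \<omega>
  have u: "u i \<in> borel_measurable M" if "i < n" for i
    unfolding u_def using measurable_compose[OF X[OF that] ksec_borel_measurable[OF rkhs k(1)]] .
  have norm_u: "(norm (u i \<omega>))\<^sup>2 \<le> \<kappa>\<^sup>2" for i \<omega>
    using ksec_reproducing[OF rkhs] k(2) by (metis u_def power2_norm_eq_inner)
  define A where "A \<omega> v = (1 / real n) *\<^sub>R (\<Sum>i<n. inner (u i \<omega>) v *\<^sub>R u i \<omega>) + lam *\<^sub>R v" for \<omega> v
  define b where "b \<omega> = (1 / real n) *\<^sub>R (\<Sum>i<n. Y i \<omega> *\<^sub>R u i \<omega>)" for \<omega>
  define c where "c = \<kappa>\<^sup>2 + lam"
  define step where "step \<omega> v = v - (lam / c\<^sup>2) *\<^sub>R (A \<omega> v - b \<omega>)" for \<omega> v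
  have lin: "linear (A \<omega>)" for \<omega>
    by (rule linearI) (simp_all add: A_def inner_add_right scaleR_add_left sum.distrib
        scaleR_add_right scaleR_sum_right algebra_simps)
  have bound: "norm (A \<omega> v) \<le> c * norm v" for \<omega> v
  proof -
    have "norm (inner (u i \<omega>) v *\<^sub>R u i \<omega>) \<le> \<kappa>\<^sup>2 * norm v" for i
    proof -
      have "norm (inner (u i \<omega>) v *\<^sub>R u i \<omega>) \<le> (norm (u i \<omega>) * norm v) * norm (u i \<omega>)"
        unfolding norm_scaleR by (intro mult_right_mono Cauchy_Schwarz_ineq2) simp
      also have "\<dots> = (norm (u i \<omega>))\<^sup>2 * norm v" by (simp add: power2_eq_square)
      also have "\<dots> \<le> \<kappa>\<^sup>2 * norm v" by (intro mult_right_mono norm_u) simp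
      finally show ?thesis .
    qed
    then have "norm (\<Sum>i<n. inner (u i \<omega>) v *\<^sub>R u i \<omega>) \<le> real n * (\<kappa>\<^sup>2 * norm v)"
      using sum_norm_bound[of "{..<n}" "\<lambda>i. inner (u i \<omega>) v *\<^sub>R u i \<omega>" "\<kappa>\<^sup>2 * norm v"] by simp
    then have "norm ((1 / real n) *\<^sub>R (\<Sum>i<n. inner (u i \<omega>) v *\<^sub>R u i \<omega>)) \<le> \<kappa>\<^sup>2 * norm v"
      using n by (simp add: divide_le_eq mult.commute)
    then show ?thesis
      unfolding A_def c_def using lam
      by (intro order_trans[OF norm_triangle_ineq]) (simp add: algebra_simps)
  qed
  have coercive: "lam * (norm v)\<^sup>2 \<le> inner (A \<omega> v) v" for \<omega> v
  proof -
    have "inner (A \<omega> v) v = (1 / real n) * (\<Sum>i<n. (inner (u i \<omega>) v)\<^sup>2) + lam * (norm v)\<^sup>2"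
      by (simp add: A_def inner_add_left inner_sum_left power2_norm_eq_inner[symmetric]
          power2_eq_square[of "inner _ _"])
    then show ?thesis by (simp add: sum_nonneg)
  qed
  have lim: "(\<lambda>m. (step \<omega> ^^ m) 0) \<longlonglongrightarrow> krr_est n evl lam (\<lambda>i. X i \<omega>) (\<lambda>i. Y i \<omega>)" for \<omega>
  proof -
    obtain v where v: "A \<omega> v = b \<omega>" "(\<lambda>m. (step \<omega> ^^ m) 0) \<longlonglongrightarrow> v"
      using coercive_iteration_converges[OF lin bound coercive lam, of \<omega> "b \<omega>"]
      unfolding step_def[abs_def] by blast
    have "krr_est n evl lam (\<lambda>i. X i \<omega>) (\<lambda>i. Y i \<omega>) = v"
      by (rule krr_est_eqI[OF rkhs lam])
        (use v(1) in \<open>simp add: A_def b_def emp_cov_op_def emp_mean_def tensor_def u_def\<close>)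
    with v(2) show ?thesis by simp
  qed
  have "(\<lambda>\<omega>. (step \<omega> ^^ m) 0) \<in> borel_measurable M" for m
  proof (induction m)
    case (Suc m)
    note [measurable] = Suc.IH
    have [measurable]: "u i \<in> borel_measurable M" "Y i \<in> borel_measurable M" if "i \<in> {..<n}" for i
      using that u Y by auto
    show ?case unfolding funpow.simps o_def step_def[of _ "(step _ ^^ m) 0"] A_def b_def
      by (intro borel_measurable_diff borel_measurable_add borel_measurable_scaleR
          borel_measurable_sum borel_measurable_inner borel_measurable_const Suc.IH u Y) auto
  qed simp
  from borel_measurable_LIMSEQ_metric[OF this lim] show ?thesis .
qed

section \<open>Coverage of the inflated bootstrap ball\<close>

text \<open>The probabilistic core, for an arbitrary estimation error \<open>W\<close> within \<open>q\<close> of \<open>Z\<close>. The absolute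
  value appears because a ball of negative radius parameter \<open>t\<close> is the same ball as for \<open>- t\<close>; where it
  matters, \<open>t\<close> is at least \<open>l - r > 0\<close>.\<close>

lemma (in prob_space) inflated_bootstrap_ball_coverage:
  fixes W Z Z' BB :: "'a \<Rightarrow> 'h::{real_normed_vector, second_countable_topology}"
  assumes sub: "subalgebra M F" and t: "t \<in> borel_measurable F"
    and W: "W \<in> borel_measurable M" and Z: "Z \<in> borel_measurable M"
    and Z': "Z' \<in> borel_measurable M"
    and Z'_gt: "\<And>r. AE \<omega> in M. real_cond_exp M F (indicator {\<omega>\<in>space M. norm (Z' \<omega>) > r}) \<omega> =
        prob {\<omega>\<in>space M. norm (Z \<omega>) > r}"
    and Z'_le: "\<And>r. AE \<omega> in M. real_cond_exp M F (indicator {\<omega>\<in>space M. norm (Z' \<omega>) \<le> r}) \<omega> =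
        prob {\<omega>\<in>space M. norm (Z \<omega>) \<le> r}"
    and \<alpha>: "0 < \<alpha>" "\<alpha> < 1" and \<eta>: "0 < \<eta>" "\<eta> < 1"
    and quantile: "AE \<omega> in M. real_cond_exp M F (indicator {\<omega>\<in>space M. norm (BB \<omega>) > t \<omega>}) \<omega> = \<alpha>"
    and gauss: "prob {\<omega>\<in>space M. norm (W \<omega> - Z \<omega>) \<le> q} \<ge> 1 - \<eta>"
    and boot: "prob {\<omega>\<in>space M. real_cond_exp M F
        (indicator {\<omega>\<in>space M. norm (BB \<omega> - Z' \<omega>) \<le> r}) \<omega> \<ge> 1 - \<eta>} \<ge> 1 - \<eta>"
    and lower: "prob {\<omega>\<in>space M. norm (Z \<omega>) \<ge> l} > \<alpha> + \<eta>"
    and l: "l - r > 0" and \<delta>: "0 \<le> \<delta>" "\<delta> \<le> 1 / 2" "q + r \<le> \<delta> * (l - r)"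
  shows "prob {\<omega>\<in>space M. norm (W \<omega>) \<le> (1 + \<delta>) * \<bar>t \<omega>\<bar>} \<ge> 1 - \<alpha> - 3 * \<eta>"
    and "prob {\<omega>\<in>space M. norm (W \<omega>) \<le> (1 - 2 * \<delta>) * (1 + \<delta>) * \<bar>t \<omega>\<bar>} \<le> 1 - \<alpha> + 3 * \<eta>"
proof -
  note [measurable] = W Z Z'
  have t_M[measurable]: "t \<in> borel_measurable M" by (rule measurable_from_subalg[OF sub t])
  define A where "A = {\<omega>\<in>space M. norm (BB \<omega>) > t \<omega>}"
  define N where "N = {\<omega>\<in>space M. norm (BB \<omega> - Z' \<omega>) \<le> r}"
  define E1 where "E1 = {\<omega>\<in>space M. norm (W \<omega> - Z \<omega>) \<le> q}"
  define E2 where "E2 = {\<omega>\<in>space M. real_cond_exp M F (indicator N) \<omega> \<ge> 1 - \<eta>}"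
  have ev: "E1 \<in> events" "E2 \<in> events" unfolding E1_def E2_def by measurable
  have E12: "prob E1 \<ge> 1 - \<eta>" "prob E2 \<ge> 1 - \<eta>"
    using gauss boot by (simp_all only: E1_def E2_def N_def)
  have A: "A \<in> events"
  proof (rule ccontr)
    assume "A \<notin> events"
    then have "AE \<omega> in M. real_cond_exp M F (indicator A) \<omega> = 0"
      by (intro AE_real_cond_exp_indicator_non_measurable[OF sub finite_measure_axioms])
        (auto simp: A_def)
    with quantile have "AE \<omega> in M. \<alpha> = 0"
      unfolding A_def[symmetric] by eventually_elim simp
    then show False using \<alpha> by simp
  qed
  have N: "N \<in> events"
  proof (rule ccontr)
    assume "N \<notin> events"
    then have "AE \<omega> in M. real_cond_exp M F (indicator N) \<omega> = 0"
      by (intro AE_real_cond_exp_indicator_non_measurable[OF sub finite_measure_axioms])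
        (auto simp: N_def)
    then have "AE \<omega> in M. \<omega> \<notin> E2"
      by eventually_elim (use \<eta> in \<open>simp add: E2_def\<close>)
    then have "prob E2 = 0" using ev(2) prob_eq_0 by blast
    then show False using E12(2) \<eta> by simp
  qed

  have upper: "AE \<omega> in M. real_cond_exp M F (indicator N) \<omega> \<ge> 1 - \<eta> \<longrightarrow>
      prob {\<omega>'\<in>space M. norm (Z \<omega>') > t \<omega> + r} \<le> \<alpha> + \<eta>"
  proof (rule conditional_tail_transfer[OF sub _ _ _ _ A quantile[folded A_def] N,
        where \<tau> = "\<lambda>\<omega>. t \<omega> + r" and V = "\<lambda>s. {\<omega>\<in>space M. norm (Z' \<omega>) > s}"
          and \<phi> = "\<lambda>s. prob {\<omega>\<in>space M. norm (Z \<omega>) > s}", OF _ _ _ Z'_gt])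
    show "(\<lambda>\<omega>. t \<omega> + r) \<in> borel_measurable F" using t by measurable
    show "{\<omega>\<in>space M. norm (Z' \<omega>) > s} \<in> events" for s by measurable
    show "antimono (\<lambda>s. {\<omega>\<in>space M. norm (Z' \<omega>) > s})"
      by (rule antimonoI) (auto intro: le_less_trans)
    show "\<omega> \<in> A" if "\<omega> \<in> N" "\<omega> \<in> {\<omega>'\<in>space M. norm (Z' \<omega>') > t \<omega> + r}" for \<omega>
      using that norm_triangle_ineq2[of "Z' \<omega>" "BB \<omega>"]
      by (simp add: A_def N_def norm_minus_commute)
  qed
  \<comment> \<open>The lower tail is the same statement for the complement of \<open>A\<close>. Negating the level turns the
    increasing family of events \<open>norm (Z' \<omega>) \<le> s\<close> into a decreasing one.\<close>
  have lower_tail: "AE \<omega> in M. real_cond_exp M F (indicator N) \<omega> \<ge> 1 - \<eta> \<longrightarrow>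
      prob {\<omega>'\<in>space M. norm (Z \<omega>') \<le> - (r - t \<omega>)} \<le> (1 - \<alpha>) + \<eta>"
  proof (rule conditional_tail_transfer[OF sub _ _ _ _ _
        AE_real_cond_exp_compl[OF sub A quantile[folded A_def]] N,
        where \<tau> = "\<lambda>\<omega>. r - t \<omega>" and V = "\<lambda>s. {\<omega>\<in>space M. norm (Z' \<omega>) \<le> - s}"
          and \<phi> = "\<lambda>s. prob {\<omega>\<in>space M. norm (Z \<omega>) \<le> - s}", OF _ _ _ Z'_le])
    show "(\<lambda>\<omega>. r - t \<omega>) \<in> borel_measurable F" using t by measurable
    show "{\<omega>\<in>space M. norm (Z' \<omega>) \<le> - s} \<in> events" for s by measurable
    show "antimono (\<lambda>s. {\<omega>\<in>space M. norm (Z' \<omega>) \<le> - s})"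
      by (rule antimonoI) auto
    show "space M - A \<in> events" using A by auto
    show "\<omega> \<in> space M - A" if "\<omega> \<in> N" "\<omega> \<in> {\<omega>'\<in>space M. norm (Z' \<omega>') \<le> - (r - t \<omega>)}" for \<omega>
      using that norm_triangle_ineq2[of "BB \<omega>" "Z' \<omega>"]
      by (simp add: A_def N_def)
  qed

  have t_ge: "t \<omega> \<ge> l - r" if "prob {\<omega>'\<in>space M. norm (Z \<omega>') > t \<omega> + r} \<le> \<alpha> + \<eta>" for \<omega>
  proof (rule ccontr)
    assume "\<not> t \<omega> \<ge> l - r"
    then have "prob {\<omega>'\<in>space M. norm (Z \<omega>') \<ge> l} \<le> prob {\<omega>'\<in>space M. norm (Z \<omega>') > t \<omega> + r}"
      by (intro finite_measure_mono) auto
    then show False using that lower by simp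
  qed
  have \<delta>t: "\<delta> * t \<omega> \<ge> q + r" if "t \<omega> \<ge> l - r" for \<omega>
    using mult_left_mono[OF that \<delta>(1)] \<delta>(3) by simp

  \<comment> \<open>\<open>E3\<close> replaces the event \<open>norm (Z \<omega>) \<le> t \<omega> + r\<close>, whose probability is not accessible because
    \<open>t\<close> is not independent of \<open>Z\<close>.\<close>
  define G where "G x = prob {\<omega>\<in>space M. - norm (Z \<omega>) \<le> x}" for x
  define E3 where "E3 = space M - {\<omega>\<in>space M. G (- norm (Z \<omega>)) \<le> \<alpha> + \<eta>}"
  have Gle: "{\<omega>\<in>space M. G (- norm (Z \<omega>)) \<le> \<alpha> + \<eta>} \<in> events"
    "prob {\<omega>\<in>space M. G (- norm (Z \<omega>)) \<le> \<alpha> + \<eta>} \<le> \<alpha> + \<eta>"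
    unfolding G_def by (rule prob_cdf_transform_le; use \<alpha> \<eta> in simp)+
  then have E3: "E3 \<in> events" "prob E3 \<ge> 1 - (\<alpha> + \<eta>)"
    unfolding E3_def by (simp_all add: prob_compl)
  define H where "H = {\<omega>\<in>space M. norm (W \<omega>) \<le> (1 + \<delta>) * \<bar>t \<omega>\<bar>}"
  have H: "H \<in> events" unfolding H_def by measurable
  have "AE \<omega> in M. \<omega> \<in> E1 \<longrightarrow> \<omega> \<in> E2 \<longrightarrow> \<omega> \<in> E3 \<longrightarrow> \<omega> \<in> H"
    using upper
  proof (eventually_elim, intro impI)
    fix \<omega>
    assume up: "real_cond_exp M F (indicator N) \<omega> \<ge> 1 - \<eta> \<longrightarrow>
        prob {\<omega>'\<in>space M. norm (Z \<omega>') > t \<omega> + r} \<le> \<alpha> + \<eta>"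
      and E: "\<omega> \<in> E1" "\<omega> \<in> E2" "\<omega> \<in> E3"
    from up E(2) have S: "prob {\<omega>'\<in>space M. norm (Z \<omega>') > t \<omega> + r} \<le> \<alpha> + \<eta>"
      by (simp add: E2_def)
    have Zle: "norm (Z \<omega>) \<le> t \<omega> + r"
    proof (rule ccontr)
      assume "\<not> ?thesis"
      then have "G (- norm (Z \<omega>)) \<le> prob {\<omega>'\<in>space M. norm (Z \<omega>') > t \<omega> + r}"
        unfolding G_def by (intro finite_measure_mono) auto
      with S E(3) show False by (simp add: E3_def)
    qed
    have "norm (W \<omega>) \<le> norm (Z \<omega>) + q"
      using E(1) norm_triangle_ineq2[of "W \<omega>" "Z \<omega>"] by (simp add: E1_def)
    also have "\<dots> \<le> (1 + \<delta>) * t \<omega>"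
      using Zle \<delta>t[OF t_ge[OF S]] by (simp add: distrib_right)
    finally show "\<omega> \<in> H"
      using E(1) t_ge[OF S] l by (simp add: H_def E1_def)
  qed
  from prob_Int3_ge[OF ev E3(1) H this] E12 E3(2)
  show "prob {\<omega>\<in>space M. norm (W \<omega>) \<le> (1 + \<delta>) * \<bar>t \<omega>\<bar>} \<ge> 1 - \<alpha> - 3 * \<eta>"
    unfolding H_def[symmetric] by linarith

  \<comment> \<open>\<open>E4\<close> plays the same part for the event \<open>norm (Z \<omega>) > t \<omega> - r\<close>.\<close>
  define G' where "G' x = prob {\<omega>\<in>space M. norm (Z \<omega>) \<le> x}" for x
  define E4 where "E4 = space M - {\<omega>\<in>space M. G' (norm (Z \<omega>)) \<le> 1 - \<alpha> + \<eta>}"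
  have "{\<omega>\<in>space M. G' (norm (Z \<omega>)) \<le> 1 - \<alpha> + \<eta>} \<in> events"
    "prob {\<omega>\<in>space M. G' (norm (Z \<omega>)) \<le> 1 - \<alpha> + \<eta>} \<le> 1 - \<alpha> + \<eta>"
    unfolding G'_def by (rule prob_cdf_transform_le; use \<alpha> \<eta> in simp)+
  then have E4: "E4 \<in> events" "prob E4 \<ge> \<alpha> - \<eta>"
    unfolding E4_def by (simp_all add: prob_compl)
  define H' where "H' = {\<omega>\<in>space M. norm (W \<omega>) \<le> (1 - 2 * \<delta>) * (1 + \<delta>) * \<bar>t \<omega>\<bar>}"
  have H': "H' \<in> events" unfolding H'_def by measurable
  have "AE \<omega> in M. \<omega> \<in> E1 \<longrightarrow> \<omega> \<in> E2 \<longrightarrow> \<omega> \<in> E4 \<longrightarrow> \<omega> \<in> space M - H'"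
    using upper lower_tail
  proof (eventually_elim, intro impI)
    fix \<omega>
    assume up: "real_cond_exp M F (indicator N) \<omega> \<ge> 1 - \<eta> \<longrightarrow>
        prob {\<omega>'\<in>space M. norm (Z \<omega>') > t \<omega> + r} \<le> \<alpha> + \<eta>"
      and low: "real_cond_exp M F (indicator N) \<omega> \<ge> 1 - \<eta> \<longrightarrow>
        prob {\<omega>'\<in>space M. norm (Z \<omega>') \<le> - (r - t \<omega>)} \<le> (1 - \<alpha>) + \<eta>"
      and E: "\<omega> \<in> E1" "\<omega> \<in> E2" "\<omega> \<in> E4"
    from up low E(2) have S: "prob {\<omega>'\<in>space M. norm (Z \<omega>') > t \<omega> + r} \<le> \<alpha> + \<eta>"
      and S': "G' (t \<omega> - r) \<le> 1 - \<alpha> + \<eta>"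
      by (simp_all add: E2_def G'_def)
    have \<omega>: "\<omega> \<in> space M" using E(1) by (simp add: E1_def)
    have t0: "t \<omega> > 0" using t_ge[OF S] l by simp
    have Zgt: "norm (Z \<omega>) > t \<omega> - r"
    proof (rule ccontr)
      assume "\<not> ?thesis"
      then have "G' (norm (Z \<omega>)) \<le> G' (t \<omega> - r)"
        unfolding G'_def by (intro finite_measure_mono) auto
      with S' E(3) show False by (simp add: E4_def)
    qed
    have "(1 - 2 * \<delta>) * (1 + \<delta>) * t \<omega> = t \<omega> - \<delta> * t \<omega> - 2 * (\<delta>\<^sup>2 * t \<omega>)"
      by (simp add: algebra_simps power2_eq_square)
    also have "\<dots> \<le> t \<omega> - \<delta> * t \<omega>" using t0 by simp
    also have "\<dots> \<le> t \<omega> - r - q" using \<delta>t[OF t_ge[OF S]] by simp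
    also have "\<dots> < norm (W \<omega>)"
      using E(1) Zgt norm_triangle_ineq2[of "Z \<omega>" "W \<omega>"] by (simp add: E1_def norm_minus_commute)
    finally show "\<omega> \<in> space M - H'" using \<omega> t0 by (simp add: H'_def)
  qed
  from prob_Int3_ge[OF ev E4(1) _ this] E12 E4(2) H'
  show "prob {\<omega>\<in>space M. norm (W \<omega>) \<le> (1 - 2 * \<delta>) * (1 + \<delta>) * \<bar>t \<omega>\<bar>} \<le> 1 - \<alpha> + 3 * \<eta>"
    unfolding H'_def[symmetric] by (simp add: prob_compl)
qed

text \<open>The factor \<open>s\<close> is 1 for the confidence set itself and \<open>1 - 2 \<delta>\<close> for its contraction towards
  \<open>fhat\<close>. Where \<open>s * t = 0\<close> both sides say that \<open>fh = f0\<close>.\<close>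

lemma mem_scaled_ball_iff:
  fixes f0 fh :: "'h::real_normed_vector"
  assumes n: "n \<ge> 1" and c: "0 \<le> c"
  shows "(\<exists>f. f0 = fh + (s * (t / sqrt (real n))) *\<^sub>R f \<and> norm f \<le> c) \<longleftrightarrow>
    norm (sqrt (real n) *\<^sub>R (fh - f0)) \<le> \<bar>s\<bar> * c * \<bar>t\<bar>"
proof
  assume "\<exists>f. f0 = fh + (s * (t / sqrt (real n))) *\<^sub>R f \<and> norm f \<le> c"
  then obtain f where f: "f0 = fh + (s * (t / sqrt (real n))) *\<^sub>R f" "norm f \<le> c" by blast
  have "sqrt (real n) *\<^sub>R (fh - f0) = - ((s * t) *\<^sub>R f)" using n by (simp add: f(1))
  then have "norm (sqrt (real n) *\<^sub>R (fh - f0)) = \<bar>s\<bar> * \<bar>t\<bar> * norm f"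
    by (simp add: abs_mult)
  also have "\<dots> \<le> \<bar>s\<bar> * \<bar>t\<bar> * c" using f(2) by (intro mult_left_mono) simp_all
  finally show "norm (sqrt (real n) *\<^sub>R (fh - f0)) \<le> \<bar>s\<bar> * c * \<bar>t\<bar>" by (simp add: mult_ac)
next
  assume le: "norm (sqrt (real n) *\<^sub>R (fh - f0)) \<le> \<bar>s\<bar> * c * \<bar>t\<bar>"
  show "\<exists>f. f0 = fh + (s * (t / sqrt (real n))) *\<^sub>R f \<and> norm f \<le> c"
  proof (cases "s * t = 0")
    case True
    then have "norm (sqrt (real n) *\<^sub>R (fh - f0)) \<le> 0" using le by auto
    then have "sqrt (real n) * norm (fh - f0) \<le> 0" by simp
    then have "fh = f0" using n by (simp add: mult_le_0_iff not_le)
    then show ?thesis using c by (intro exI[of _ 0]) simp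
  next
    case False
    define f where "f = (sqrt (real n) / (s * t)) *\<^sub>R (f0 - fh)"
    have "f0 = fh + (s * (t / sqrt (real n))) *\<^sub>R f" using False n by (simp add: f_def)
    moreover have "norm f = norm (sqrt (real n) *\<^sub>R (fh - f0)) / (\<bar>s\<bar> * \<bar>t\<bar>)"
      by (simp add: f_def abs_mult norm_minus_commute)
    then have "norm f \<le> c" using le False by (simp add: divide_le_eq mult_ac abs_mult[symmetric])
    ultimately show ?thesis by blast
  qed
qed

theorem proposition1:
  fixes M :: "'m measure"
    and k :: "'s::polish_space \<Rightarrow> 's \<Rightarrow> real" and \<kappa> :: real
    and evl :: "'h::{real_inner, banach, second_countable_topology} \<Rightarrow> 's \<Rightarrow> real"
    and P :: "('s \<times> real) measure"
    and n :: nat and X :: "nat \<Rightarrow> 'm \<Rightarrow> 's" and Y :: "nat \<Rightarrow> 'm \<Rightarrow> real"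
    and f0 :: 'h and \<sigma>_up \<sigma>_low :: real
    and h :: "nat \<Rightarrow> nat \<Rightarrow> 'm \<Rightarrow> real"
    and lam \<alpha> \<eta> \<delta> :: real
    and Q R :: "nat \<Rightarrow> real \<Rightarrow> real \<Rightarrow> real"
    and L :: "real \<Rightarrow> real \<Rightarrow> real" and B :: "real \<Rightarrow> real"
    and Z Z' :: "'m \<Rightarrow> 'h" and K :: "'m \<Rightarrow> 'h measure"
    and D :: "'m \<Rightarrow> nat \<Rightarrow> 's \<times> real" and F :: "'m measure"
    and fhat BB :: "'m \<Rightarrow> 'h" and flam :: 'h and Sig :: "'h \<Rightarrow> 'h"
    and that :: "'m \<Rightarrow> real"
  assumes M: "prob_space M"
    and kernel: "pos_def_kernel k" "\<And>x x'. k x x' \<le> \<kappa>\<^sup>2"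
    and kernel_measurable: "(\<lambda>(x, x'). k x x') \<in> borel_measurable (borel \<Otimes>\<^sub>M borel)"
    and rkhs: "rkhs k evl"
    and n: "n \<ge> 1"
    and data_indep:
      "prob_space.indep_vars M (\<lambda>_. borel \<Otimes>\<^sub>M borel) (\<lambda>i \<omega>. (X i \<omega>, Y i \<omega>)) {..<n}"
    and data_law: "\<And>i. i < n \<Longrightarrow> distr M (borel \<Otimes>\<^sub>M borel) (\<lambda>\<omega>. (X i \<omega>, Y i \<omega>)) = P"
    and f0: "AE p in P. evl f0 (fst p) =
        real_cond_exp P (vimage_algebra (space P) fst borel) snd p"
    and noise_bound: "AE p in P. \<bar>snd p - evl f0 (fst p)\<bar> \<le> \<sigma>_up"
    and noise_var: "\<sigma>_low > 0"
      "AE p in P. real_cond_exp P (vimage_algebra (space P) fst borel)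
        (\<lambda>p. (snd p - evl f0 (fst p))\<^sup>2) p \<ge> \<sigma>_low\<^sup>2"
    and D: "D = (\<lambda>\<omega>. \<lambda>i\<in>{..<n}. (X i \<omega>, Y i \<omega>))"
    and F: "F = vimage_algebra (space M) D (\<Pi>\<^sub>M i\<in>{..<n}. borel \<Otimes>\<^sub>M borel)"
    and lam: "lam > 0"
    and fhat: "fhat = (\<lambda>\<omega>. krr_est n evl lam (\<lambda>i. X i \<omega>) (\<lambda>i. Y i \<omega>))"
    and flam: "flam = krr_pop P evl lam"
    and Sig: "Sig = Sigma_op P k evl lam f0"
    and mult_indep: "prob_space.indep_vars M (\<lambda>_. borel) (\<lambda>(i, j). h i j) ({..<n} \<times> {..<n})"
    and mult_law: "\<And>i j. i < n \<Longrightarrow> j < n \<Longrightarrow> distributed M lborel (h i j) std_normal_density"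
    and mult_data_indep: "prob_space.indep_set M (sets F)
        (sets (vimage_algebra (space M) (\<lambda>\<omega>. \<lambda>ij\<in>{..<n} \<times> {..<n}. h (fst ij) (snd ij) \<omega>)
          (\<Pi>\<^sub>M ij\<in>{..<n} \<times> {..<n}. borel)))"
    and BB: "BB = (\<lambda>\<omega>. bootstrap n k evl lam (\<lambda>i. X i \<omega>) (\<lambda>i. Y i \<omega>) (\<lambda>i j. h i j \<omega>))"
    and level: "0 < \<alpha>" "\<alpha> < 1" "0 < \<eta>" "\<eta> < 1" "\<eta> < min \<alpha> ((1 - \<alpha>) / 2)"
    and that: "that \<in> borel_measurable F"
      "AE \<omega> in M. cprob M F (\<lambda>\<omega>'. norm (BB \<omega>') > that \<omega>') \<omega> = \<alpha>"
    and Z: "Z \<in> borel_measurable M" "gaussian_with_cov (distr M borel Z) Sig"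
    and gauss_approx:
      "\<P>(\<omega> in M. norm (sqrt (real n) *\<^sub>R (fhat \<omega> - flam) - Z \<omega>) \<le> Q n lam \<eta>) \<ge> 1 - \<eta>"
    and Z': "Z' \<in> borel_measurable M" "cond_distr M F borel Z' K"
      "AE \<omega> in M. gaussian_with_cov (K \<omega>) Sig"
    and boot_approx:
      "\<P>(\<omega> in M. cprob M F (\<lambda>\<omega>'. norm (BB \<omega>' - Z' \<omega>') \<le> R n lam \<eta>) \<omega> \<ge> 1 - \<eta>) \<ge> 1 - \<eta>"
    and var_lower: "\<And>\<eta>'. 0 < \<eta>' \<Longrightarrow> \<eta>' < 1 \<Longrightarrow> \<P>(\<omega> in M. norm (Z \<omega>) \<ge> L lam \<eta>') \<ge> 1 - \<eta>'"
      "strict_mono_on {0<..<1} (L lam)"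
    and bias_upper: "sqrt (real n) * norm (flam - f0) \<le> B lam"
    and denom: "L lam (1 - \<alpha> - 2 * \<eta>) - (Q n lam \<eta> + R n lam \<eta>) > 0"
    and delta: "\<delta> \<le> 1 / 2"
      "\<delta> \<ge> ((Q n lam \<eta> + R n lam \<eta>) + B lam) /
           (L lam (1 - \<alpha> - 2 * \<eta>) - (Q n lam \<eta> + R n lam \<eta>))"
  shows
   "valid_set M \<alpha> (3 * \<eta>) f0 (\<lambda>\<omega>. conf_set n (fhat \<omega>) (that \<omega>) \<delta>) \<and>
    sharp_set M \<alpha> (2 * \<delta>) (3 * \<eta>) f0 fhat (\<lambda>\<omega>. conf_set n (fhat \<omega>) (that \<omega>) \<delta>)"
proof -
  interpret prob_space M by (rule M)
  have XY[measurable]: "(\<lambda>\<omega>. (X i \<omega>, Y i \<omega>)) \<in> M \<rightarrow>\<^sub>M borel \<Otimes>\<^sub>M borel" if "i < n" for i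
    using data_indep that by (auto simp: indep_vars_def)
  have X: "X i \<in> M \<rightarrow>\<^sub>M borel" if "i < n" for i
    using measurable_compose[OF XY[OF that] measurable_fst] by simp
  have Y: "Y i \<in> borel_measurable M" if "i < n" for i
    using measurable_compose[OF XY[OF that] measurable_snd] by simp
  have k: "k x \<in> borel_measurable borel" for x
    using measurable_Pair2[OF kernel_measurable, of x] by simp
  have fhat_meas[measurable]: "fhat \<in> borel_measurable M"
    unfolding fhat by (rule krr_est_borel_measurable[OF rkhs k kernel(2) n lam X Y])
  have D_meas: "D \<in> M \<rightarrow>\<^sub>M (\<Pi>\<^sub>M i\<in>{..<n}. borel \<Otimes>\<^sub>M borel)"
    unfolding D using XY by (intro measurable_restrict) auto
  have sub: "subalgebra M F"
    unfolding subalgebra_def F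
    using D_meas measurable_space[OF D_meas] measurable_sets[OF D_meas]
    by (auto simp: sets_vimage_algebra2)
  note [measurable] = Z(1) Z'(1)
  have that_M[measurable]: "that \<in> borel_measurable M" by (rule measurable_from_subalg[OF sub that(1)])

  define W where "W \<omega> = sqrt (real n) *\<^sub>R (fhat \<omega> - f0)" for \<omega>
  have W_meas[measurable]: "W \<in> borel_measurable M" unfolding W_def by measurable

  \<comment> \<open>The bias is charged to the approximation error, since \<open>W\<close> is centered at \<open>f0\<close> instead of
    \<open>flam\<close>.\<close>
  define q where "q = Q n lam \<eta> + B lam"
  define r where "r = R n lam \<eta>"
  define l where "l = L lam (1 - \<alpha> - 2 * \<eta>)"
  have B0: "B lam \<ge> 0" using bias_upper by (rule order_trans[rotated]) simp
  \<comment> \<open>\<open>Q\<close> and \<open>R\<close> are nonnegative since they bound norms on events of positive probability. Together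
    with \<open>B \<ge> 0\<close> this makes \<open>\<delta>\<close> nonnegative.\<close>
  have Q0: "Q n lam \<eta> \<ge> 0"
  proof (rule ccontr)
    assume "\<not> ?thesis"
    then have none: "\<not> norm x \<le> Q n lam \<eta>" for x :: 'h using norm_ge_zero[of x] by linarith
    show False using gauss_approx level by (simp add: none)
  qed
  have r0: "r \<ge> 0"
  proof (rule ccontr)
    assume "\<not> ?thesis"
    then have none: "\<not> norm x \<le> R n lam \<eta>" for x :: 'h
      using norm_ge_zero[of x] unfolding r_def by linarith
    interpret F: finite_measure_subalgebra M F by unfold_locales (rule sub)
    have "AE \<omega> in M. real_cond_exp M F (indicator {}) \<omega> = indicator {} \<omega>"
      by (rule F.real_cond_exp_F_meas) simp_all
    then have "AE \<omega> in M. \<not> cprob M F (\<lambda>\<omega>'. norm (BB \<omega>' - Z' \<omega>') \<le> R n lam \<eta>) \<omega> \<ge> 1 - \<eta>"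
      by eventually_elim (use level in \<open>simp add: cprob_def none\<close>)
    moreover have "{\<omega>\<in>space M. cprob M F (\<lambda>\<omega>'. norm (BB \<omega>' - Z' \<omega>') \<le> R n lam \<eta>) \<omega> \<ge> 1 - \<eta>} \<in> events"
      unfolding cprob_def by measurable
    ultimately have "\<P>(\<omega> in M. cprob M F (\<lambda>\<omega>'. norm (BB \<omega>' - Z' \<omega>') \<le> R n lam \<eta>) \<omega> \<ge> 1 - \<eta>) = 0"
      by (subst prob_eq_0) auto
    then show False using boot_approx level by simp
  qed
  have \<delta>': "q + r \<le> \<delta> * (l - (Q n lam \<eta> + r))"
    using delta(2) denom by (simp add: pos_divide_le_eq q_def r_def l_def algebra_simps)
  have \<delta>0: "\<delta> \<ge> 0"
  proof -
    have "0 \<le> (Q n lam \<eta> + R n lam \<eta> + B lam) / (L lam (1 - \<alpha> - 2 * \<eta>) - (Q n lam \<eta> + R n lam \<eta>))"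
      using Q0 r0 B0 denom by (intro divide_nonneg_pos) (simp_all add: r_def)
    then show ?thesis using delta(2) by linarith
  qed
  have \<delta>3: "q + r \<le> \<delta> * (l - r)"
  proof -
    have "\<delta> * (l - (Q n lam \<eta> + r)) \<le> \<delta> * (l - r)" using Q0 \<delta>0 by (intro mult_left_mono) simp_all
    with \<delta>' show ?thesis by linarith
  qed
  have l: "l - r > 0" using denom Q0 by (simp add: l_def r_def)
  have lower: "prob {\<omega>\<in>space M. norm (Z \<omega>) \<ge> l} > \<alpha> + \<eta>"
    using var_lower(1)[of "1 - \<alpha> - 2 * \<eta>"] level by (simp add: l_def)

  have gauss: "prob {\<omega>\<in>space M. norm (W \<omega> - Z \<omega>) \<le> q} \<ge> 1 - \<eta>"
  proof -
    have "norm (W \<omega> - Z \<omega>) \<le> q"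
      if "norm (sqrt (real n) *\<^sub>R (fhat \<omega> - flam) - Z \<omega>) \<le> Q n lam \<eta>" for \<omega>
    proof -
      have "W \<omega> - Z \<omega> = (sqrt (real n) *\<^sub>R (fhat \<omega> - flam) - Z \<omega>) + sqrt (real n) *\<^sub>R (flam - f0)"
        by (simp add: W_def algebra_simps)
      then have "norm (W \<omega> - Z \<omega>) \<le>
          norm (sqrt (real n) *\<^sub>R (fhat \<omega> - flam) - Z \<omega>) + norm (sqrt (real n) *\<^sub>R (flam - f0))"
        by (metis norm_triangle_ineq)
      then show ?thesis using that bias_upper by (simp add: q_def)
    qed
    then have "\<P>(\<omega> in M. norm (sqrt (real n) *\<^sub>R (fhat \<omega> - flam) - Z \<omega>) \<le> Q n lam \<eta>)
        \<le> prob {\<omega>\<in>space M. norm (W \<omega> - Z \<omega>) \<le> q}"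
      by (intro finite_measure_mono) auto
    with gauss_approx show ?thesis by linarith
  qed

  \<comment> \<open>Conditionally on the data \<open>Z'\<close> has the covariance of \<open>Z\<close>, hence its norm has the unconditional
    law of the norm of \<open>Z\<close>.\<close>
  have norm_law: "AE \<omega> in M. measure (K \<omega>) {z. norm z \<le> s} = prob {\<omega>\<in>space M. norm (Z \<omega>) \<le> s}" for s
    using Z'(3)
  proof eventually_elim
    case (elim \<omega>)
    have "measure (K \<omega>) {z. norm z \<le> s} = measure (distr M borel Z) {z. norm z \<le> s}"
      by (rule gaussian_norm_law_unique[OF elim Z(2)])
    also have "\<dots> = prob {\<omega>\<in>space M. norm (Z \<omega>) \<le> s}"
      by (subst measure_distr) (auto intro!: arg_cong[where f = prob])
    finally show ?case .
  qed
  have Z'_le: "AE \<omega> in M. real_cond_exp M F (indicator {\<omega>\<in>space M. norm (Z' \<omega>) \<le> s}) \<omega> =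
      prob {\<omega>\<in>space M. norm (Z \<omega>) \<le> s}" for s
  proof -
    have "{z :: 'h. norm z \<le> s} \<in> sets borel" by measurable
    then have "AE \<omega> in M. measure (K \<omega>) {z. norm z \<le> s} =
        cprob M F (\<lambda>\<omega>'. Z' \<omega>' \<in> {z. norm z \<le> s}) \<omega>"
      using Z'(2) unfolding cond_distr_def by blast
    with norm_law[of s] show ?thesis
      by eventually_elim (simp add: cprob_def)
  qed
  have Z'_gt: "AE \<omega> in M. real_cond_exp M F (indicator {\<omega>\<in>space M. norm (Z' \<omega>) > s}) \<omega> =
      prob {\<omega>\<in>space M. norm (Z \<omega>) > s}" for s
  proof -
    have compl: "{\<omega>\<in>space M. norm (V \<omega>) > s} = space M - {\<omega>\<in>space M. norm (V \<omega>) \<le> s}"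
      for V :: "'m \<Rightarrow> 'h" by auto
    have "{\<omega>\<in>space M. norm (Z \<omega>) \<le> s} \<in> events" "{\<omega>\<in>space M. norm (Z' \<omega>) \<le> s} \<in> events"
      by measurable
    with AE_real_cond_exp_compl[OF sub _ Z'_le[of s]] show ?thesis
      unfolding compl by (simp add: prob_compl)
  qed

  have cover:
    "prob {\<omega>\<in>space M. norm (W \<omega>) \<le> (1 + \<delta>) * \<bar>that \<omega>\<bar>} \<ge> 1 - \<alpha> - 3 * \<eta>"
    "prob {\<omega>\<in>space M. norm (W \<omega>) \<le> (1 - 2 * \<delta>) * (1 + \<delta>) * \<bar>that \<omega>\<bar>} \<le> 1 - \<alpha> + 3 * \<eta>"
    using inflated_bootstrap_ball_coverage[OF sub that(1) W_meas Z(1) Z'(1) Z'_gt Z'_le level(1,2,3,4)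
        that(2)[unfolded cprob_def] gauss boot_approx[unfolded cprob_def, folded r_def] lower l \<delta>0 delta(1) \<delta>3]
    by blast+

  have mem: "f0 \<in> conf_set n (fhat \<omega>) (that \<omega>) \<delta> \<longleftrightarrow> norm (W \<omega>) \<le> (1 + \<delta>) * \<bar>that \<omega>\<bar>" for \<omega>
    using mem_scaled_ball_iff[OF n, of "1 + \<delta>" f0 "fhat \<omega>" 1 "that \<omega>"] \<delta>0
    by (simp add: conf_set_def W_def)
  have mem': "f0 \<in> (\<lambda>g. (2 * \<delta>) *\<^sub>R fhat \<omega> + (1 - 2 * \<delta>) *\<^sub>R g) ` conf_set n (fhat \<omega>) (that \<omega>) \<delta> \<longleftrightarrow>
      norm (W \<omega>) \<le> (1 - 2 * \<delta>) * (1 + \<delta>) * \<bar>that \<omega>\<bar>" for \<omega>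
  proof -
    have "(2 * \<delta>) *\<^sub>R fhat \<omega> + (1 - 2 * \<delta>) *\<^sub>R (fhat \<omega> + (that \<omega> / sqrt (real n)) *\<^sub>R f) =
        fhat \<omega> + ((1 - 2 * \<delta>) * (that \<omega> / sqrt (real n))) *\<^sub>R f" for f
      by (simp add: algebra_simps)
    then have "f0 \<in> (\<lambda>g. (2 * \<delta>) *\<^sub>R fhat \<omega> + (1 - 2 * \<delta>) *\<^sub>R g) ` conf_set n (fhat \<omega>) (that \<omega>) \<delta> \<longleftrightarrow>
        (\<exists>f. f0 = fhat \<omega> + ((1 - 2 * \<delta>) * (that \<omega> / sqrt (real n))) *\<^sub>R f \<and> norm f \<le> 1 + \<delta>)"
      by (auto simp: conf_set_def image_iff)
    also have "\<dots> \<longleftrightarrow> norm (W \<omega>) \<le> \<bar>1 - 2 * \<delta>\<bar> * (1 + \<delta>) * \<bar>that \<omega>\<bar>"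
      unfolding W_def by (rule mem_scaled_ball_iff[OF n]) (use \<delta>0 in simp)
    finally show ?thesis using delta(1) by simp
  qed
  show ?thesis
    unfolding valid_set_def sharp_set_def mem mem' using cover by simp
qed

end
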